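(* Suppose that $M(U,\tau)$ is a proper Moufang set (finite or infinite) such that (a) $U$ is nilpotent; (b) for every $b\in U^\#$ there is a special involution $a\in Z(U)\cap V_b$. Then $U$ is an elementary abelian $2$-group and $M(U,\tau)$ is special.
   Context: Permutations act on the right and $g^h=h^{-1}gh$. A Moufang set is a set $X$ with $|X|\ge 3$ together with subgroups $(U_x)_{x\in X}$ of $\mathrm{Sym}(X)$ (root groups) such that each $U_x$ fixes $x$ and acts regularly on $X\setminus\{x\}$, and $U_x^g=U_{xg}$ for all $x\in X$ and $g\in G^\dagger:=\langle U_y\mid y\in X\rangle$. Construction $M(U,\tau)$: let $(U,+)$ be a (not necessarily abelian) group with neutral element $0$, $U^\#=U\setminus\{0\}$, $X=U\cup\{\infty\}$ (disjoint union), and $\tau\in\mathrm{Sym}(X)$ interchanging $0$ and $\infty$. For $a\in U$ let $\alpha_a\in\mathrm{Sym}(X)$ be given by $\infty\alpha_a=\infty$, $b\alpha_a=b+a$; put $U_\infty=\{\alpha_a\mid a\in U\}$ and $U_a=U_\infty^{\tau\alpha_a}$ for $a\in U$. When $(X,(U_x)_{x\in X})$ is a Moufang set it is denoted $M(U,\tau)$. It is proper if $G^\dagger$ is not sharply $2$-transitive on $X$. For $a\in U^\#$, $\mu_a=\alpha_{(-a)\tau^{-1}}^{\tau}\,\alpha_a\,\alpha_{-(a\tau^{-1})}^{\tau}$; it is the unique element of $U_0\alpha_aU_0$ interchanging $0$ and $\infty$. For $a\in U^\#$ put $V_a=\{b\in U^\#\mid\mu_b=\mu_a\}$. An involution in $U$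 is an element of order $2$. An element $a\in U^\#$ is special if $(-a)\tau^{-1}=-(a\tau^{-1})$. $M(U,\tau)$ is special if $(-a)\tau=-(a\tau)$ for all $a\in U^\#$. *)

theory Defs
  imports "HOL-Algebra.Bij" "HOL-Algebra.Generated_Groups"
begin

text \<open>
  Permutations act on the right in the informal text: the product \<open>g h\<close> means ``first \<open>g\<close>, then
  \<open>h\<close>'', i.e. the function \<open>h \<circ> g\<close>. Accordingly \<open>g\<close> to the power \<open>h\<close>, which is \<open>h\<inverse> g h\<close>, is the
  function \<open>h \<circ> g \<circ> h\<inverse>\<close>. The library group \<open>BijGroup UNIV\<close> multiplies in the opposite order, which
  affects neither its subgroups nor generation of subgroups.
\<close>

definition perm_conj :: "('x \<Rightarrow> 'x) \<Rightarrow> ('x \<Rightarrow> 'x) \<Rightarrow> 'x \<Rightarrow> 'x" where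
  "perm_conj g h = h \<circ> g \<circ> inv_into UNIV h"

definition regular_on :: "('x \<Rightarrow> 'x) set \<Rightarrow> 'x set \<Rightarrow> bool" where
  "regular_on H Y \<longleftrightarrow> (\<forall>y\<in>Y. \<forall>z\<in>Y. \<exists>!h. h \<in> H \<and> h y = z)"

definition sharply_2_transitive :: "('x \<Rightarrow> 'x) set \<Rightarrow> bool" where
  "sharply_2_transitive H \<longleftrightarrow>
     (\<forall>x y x' y'. x \<noteq> y \<longrightarrow> x' \<noteq> y' \<longrightarrow> (\<exists>!h. h \<in> H \<and> h x = x' \<and> h y = y'))"

text \<open>A family of root groups on \<open>X = UNIV\<close> and the group \<open>G\<^sup>\<dagger>\<close> it generates.\<close>

definition little_projective_group :: "('x \<Rightarrow> ('x \<Rightarrow> 'x) set) \<Rightarrow> ('x \<Rightarrow> 'x) set" where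
  "little_projective_group R = generate (BijGroup UNIV) (\<Union>x. R x)"

definition moufang_set :: "('x \<Rightarrow> ('x \<Rightarrow> 'x) set) \<Rightarrow> bool" where
  "moufang_set R \<longleftrightarrow>
     (infinite (UNIV :: 'x set) \<or> card (UNIV :: 'x set) \<ge> 3) \<and>
     (\<forall>x. subgroup (R x) (BijGroup UNIV)) \<and>
     (\<forall>x. \<forall>g\<in>R x. g x = x) \<and>
     (\<forall>x. regular_on (R x) (UNIV - {x})) \<and>
     (\<forall>x. \<forall>g\<in>little_projective_group R. (\<lambda>u. perm_conj u g) ` R x = R (g x))"

definition proper_moufang_set :: "('x \<Rightarrow> ('x \<Rightarrow> 'x) set) \<Rightarrow> bool" where
  "proper_moufang_set R \<longleftrightarrow>
     moufang_set R \<and> \<not> sharply_2_transitive (little_projective_group R)"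

text \<open>
  The construction \<open>M(U,\<tau>)\<close>: \<open>U\<close> is the universe of a type of class \<open>group_add\<close> (not assumed
  commutative), \<open>X = U \<union> {\<infinity>}\<close> is its option type, with \<open>None\<close> as \<open>\<infinity>\<close>.
\<close>

definition interchanges_0_infinity :: "('u::group_add option \<Rightarrow> 'u option) \<Rightarrow> bool" where
  "interchanges_0_infinity \<tau> \<longleftrightarrow> bij \<tau> \<and> \<tau> (Some 0) = None \<and> \<tau> None = Some 0"

definition alpha :: "'u::group_add \<Rightarrow> 'u option \<Rightarrow> 'u option" where
  "alpha a = map_option (\<lambda>b. b + a)"

definition root_groups ::
  "('u::group_add option \<Rightarrow> 'u option) \<Rightarrow> 'u option \<Rightarrow> ('u option \<Rightarrow> 'u option) set" where
  "root_groups \<tau> x =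
     (case x of
        None \<Rightarrow> range alpha
      | Some a \<Rightarrow> (\<lambda>u. perm_conj u (alpha a \<circ> \<tau>)) ` range alpha)"

text \<open>
  If \<open>f\<close> is a permutation of \<open>X\<close> interchanging \<open>0\<close> and \<open>\<infinity>\<close>, then \<open>at_U f a\<close> is the image of \<open>a\<close> under
  \<open>f\<close>, viewed as an element of \<open>U\<close>; it is unspecified for \<open>a = 0\<close>, whose image is \<open>\<infinity>\<close>.
\<close>

definition at_U :: "('u::group_add option \<Rightarrow> 'u option) \<Rightarrow> 'u \<Rightarrow> 'u" where
  "at_U f a = the (f (Some a))"

definition mu :: "('u::group_add option \<Rightarrow> 'u option) \<Rightarrow> 'u \<Rightarrow> 'u option \<Rightarrow> 'u option" where
  "mu \<tau> a =
     perm_conj (alpha (- at_U (inv_into UNIV \<tau>) a)) \<tau> \<circ>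
     alpha a \<circ>
     perm_conj (alpha (at_U (inv_into UNIV \<tau>) (- a))) \<tau>"

definition V_set :: "('u::group_add option \<Rightarrow> 'u option) \<Rightarrow> 'u \<Rightarrow> 'u set" where
  "V_set \<tau> a = {b. b \<noteq> 0 \<and> mu \<tau> b = mu \<tau> a}"

definition special_element :: "('u::group_add option \<Rightarrow> 'u option) \<Rightarrow> 'u \<Rightarrow> bool" where
  "special_element \<tau> a \<longleftrightarrow>
     a \<noteq> 0 \<and> at_U (inv_into UNIV \<tau>) (- a) = - at_U (inv_into UNIV \<tau>) a"

definition special_moufang :: "('u::group_add option \<Rightarrow> 'u option) \<Rightarrow> bool" where
  "special_moufang \<tau> \<longleftrightarrow> (\<forall>a. a \<noteq> 0 \<longrightarrow> at_U \<tau> (- a) = - at_U \<tau> a)"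

definition group_center :: "'u::group_add set" where
  "group_center = {a. \<forall>b. a + b = b + a}"

text \<open>
  The \<open>n\<close>-th term of the upper central series; membership of all commutators \<open>[a,b]\<close> in the
  \<open>n\<close>-th term says that \<open>a\<close> is central modulo that term.
\<close>

primrec upper_central :: "nat \<Rightarrow> 'u::group_add set" where
  "upper_central 0 = {0}"
| "upper_central (Suc n) = {a. \<forall>b. - a + - b + a + b \<in> upper_central n}"

definition nilpotent_group :: "'u::group_add itself \<Rightarrow> bool" where
  "nilpotent_group _ \<longleftrightarrow> (\<exists>n. upper_central n = (UNIV :: 'u set))"

definition involution :: "'u::group_add \<Rightarrow> bool" where
  "involution a \<longleftrightarrow> a \<noteq> 0 \<and> a + a = 0"

definition elementary_abelian_2_group :: "'u::group_add itself \<Rightarrow> bool" where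
  "elementary_abelian_2_group _ \<longleftrightarrow>
     (\<forall>a b :: 'u. a + b = b + a) \<and> (\<forall>a :: 'u. a \<noteq> 0 \<longrightarrow> involution a)"

end

theory Submission
  imports Defs
begin

text \<open>
  By (b) every \<open>\<mu>\<^sub>x\<close> is an involution which equals \<open>\<mu>\<^sub>e\<close> for some special central involution \<open>e\<close>, and
  \<open>\<mu>\<^sub>e\<close> is conjugate to \<open>\<alpha>\<^sub>e\<close>, hence fixes \<open>e\<close> and nothing else. Since \<open>\<infinity>\<close> is the only fixed point of
  a nontrivial \<open>\<alpha>\<^sub>d\<close>, it follows that every involution of \<open>U\<close> is central and special, and that each
  \<open>V\<^sub>x\<close> contains exactly one of them. Properness provides at least two.

  Let \<open>\<mu>\<^sub>p = \<mu>\<^sub>a\<close> with \<open>a\<close> an involution and \<open>2p \<noteq> 0\<close>. The six images of \<open>p\<close> under negation and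
  \<open>\<mu>\<^sub>p\<close>, the additivity of the Hua maps \<open>\<mu>\<^sub>x \<mu>\<^sub>y\<close>, and a change of base point from \<open>p\<close> to \<open>p + b\<close>
  for involutions \<open>b\<close> yield relations between the points \<open>(b \<plusminus> p)\<mu>\<^sub>p\<close>. If \<open>p\<close> is central, they force
  \<open>2p\<close> to be fixed by all Hua maps, and then so is the involution in \<open>V\<^bsub>2p\<^esub>\<close>; this is impossible
  when there are two involutions. So the center \<open>Z\<close> of \<open>U\<close> has exponent 2. If \<open>p\<close> is in the second
  center but not in \<open>Z\<close>, they force \<open>2p = a\<close>. The same holds for \<open>p + b\<close> in place of \<open>p\<close>, and as
  \<open>2(p + b) = 2p\<close> this gives \<open>\<mu>\<^bsub>p+b\<^esub> = \<mu>\<^sub>p\<close> for all \<open>b\<close>, which again leaves room for only one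
  involution. Hence the upper central series stops at \<open>Z\<close>, and \<open>U = Z\<close> by nilpotency.
\<close>

section \<open>Involutive \<open>\<mu>\<close>-maps\<close>

text \<open>
  The locale axiomatizes the permutations \<open>\<mu>\<^sub>x\<close> acting on \<open>U\<close>, with the junk value \<open>0\<close> at \<open>0\<close> in place
  of \<open>\<infinity>\<close>. Composites of an even number of them fix \<open>0\<close>, so on these no information is lost.
\<close>

locale mu_maps =
  fixes n :: "'u::group_add \<Rightarrow> 'u \<Rightarrow> 'u"
  assumes n_zero: "x \<noteq> 0 \<Longrightarrow> n x 0 = 0"
    and n_n [simp]: "x \<noteq> 0 \<Longrightarrow> n x (n x w) = w"
    and hua_add: "x \<noteq> 0 \<Longrightarrow> y \<noteq> 0 \<Longrightarrow> n x (n y (v + w)) = n x (n y v) + n x (n y w)"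
    and n_minus: "x \<noteq> 0 \<Longrightarrow> n (- x) = n x"
    and n_hua: "x \<noteq> 0 \<Longrightarrow> y \<noteq> 0 \<Longrightarrow> w \<noteq> 0 \<Longrightarrow>
      n (n x (n y w)) u = n x (n y (n w (n y (n x u))))"
    and n_self: "x \<noteq> 0 \<Longrightarrow> n (n x x) = n x"
    and n_hexagon: "x \<noteq> 0 \<Longrightarrow> n x (- n x (- x)) = - n x x"
    and n_add: "x \<noteq> 0 \<Longrightarrow> w \<noteq> 0 \<Longrightarrow> w + x \<noteq> 0 \<Longrightarrow>
      n x (w + x) = n x (n x w - n x (- x)) + n x x"
    and n_sum: "x \<noteq> 0 \<Longrightarrow> b \<noteq> 0 \<Longrightarrow> b + b = 0 \<Longrightarrow> n b b = b \<Longrightarrow> b + x \<noteq> 0 \<Longrightarrow>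
      n (n x b - n x (- x)) u = n x (n b (n (b + x) u))"
    and ex_fixed: "x \<noteq> 0 \<Longrightarrow>
      \<exists>e. e \<noteq> 0 \<and> e + e = 0 \<and> (\<forall>w. e + w = w + e) \<and> n e e = e \<and> n e = n x"
    and two_classes: "\<exists>x y. x \<noteq> 0 \<and> y \<noteq> 0 \<and> n x \<noteq> n y"
begin

section \<open>Involutions of \<open>U\<close> and their uniqueness within each class of equal
  \<mu>-maps\<close>

lemma n_eq_0_iff [simp]: "x \<noteq> 0 \<Longrightarrow> n x w = 0 \<longleftrightarrow> w = 0"
  by (metis n_n n_zero)

lemma n_inject: "x \<noteq> 0 \<Longrightarrow> n x v = n x w \<Longrightarrow> v = w"
  by (metis n_n)

lemma hua_minus:
  assumes "x \<noteq> 0" "y \<noteq> 0"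
  shows "n x (n y (- v)) = - n x (n y v)"
proof -
  have "n x (n y (- v)) + n x (n y v) = 0"
    using hua_add[OF assms, of "- v" v] assms by (simp add: n_zero)
  then show ?thesis
    by (simp add: eq_neg_iff_add_eq_0)
qed

lemma hua_diff:
  assumes "x \<noteq> 0" "y \<noteq> 0"
  shows "n x (n y (v - w)) = n x (n y v) - n x (n y w)"
  by (metis assms diff_conv_add_uminus hua_add hua_minus)

text \<open>The involution \<open>\<alpha>\<^sub>d\<close> is conjugate to \<open>\<mu>\<^sub>c\<close>, so it would inherit a fixed point other than \<open>\<infinity>\<close>.\<close>

lemma involution_fixed:
  assumes "d \<noteq> 0" "d + d = 0"
  shows "n d d = d \<and> (\<forall>w. d + w = w + d)"
proof -
  obtain c where c: "c \<noteq> 0" "c + c = 0" "\<forall>w. c + w = w + c" "n c c = c" "n c = n d"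
    using ex_fixed[OF assms(1)] by blast
  have md: "- d = d"
    using assms(2) by (simp add: minus_unique)
  define y where "y = n d d"
  have "c + y = 0"
  proof (rule ccontr)
    assume ne: "c + y \<noteq> 0"
    \<comment> \<open>Chosen so that \<open>n_add\<close> reads
      \<open>n d (w + d) = n d c + y = c + y = n d w\<close>, using \<open>n d c = c\<close>; then
      \<open>d\<close> would be \<open>0\<close>.\<close>
    define w where "w = n d (c + y)"
    have w: "w \<noteq> 0" "n d w = c + y"
      using ne assms by (auto simp: w_def)
    have "w + d \<noteq> 0"
    proof
      assume "w + d = 0"
      then have "w = d"
        using md by (metis add_eq_0_iff2)
      then have "c + y = y"
        using w y_def by simp
      then show False
        using c(1) by (metis add_0_left add_right_cancel)
    qed
    then have "n d (w + d) = n d (c + y - y) + y"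
      using n_add[of d w] assms w by (simp add: md y_def)
    also have "\<dots> = n d w"
      using c(4,5) w by simp
    finally have "w + d = w"
      using n_inject[OF assms(1)] by blast
    then show False
      using assms(1) by (metis add_0_right add_left_cancel)
  qed
  then have "y = c"
    using c(2) by (metis add_left_cancel)
  then have "d = c"
    using c(4,5) assms(1) y_def by (metis n_n)
  then show ?thesis
    using c(3,4) by blast
qed

lemma involution_commute:
  fixes d :: 'u
  assumes "d + d = 0"
  shows "d + w = w + d"
proof (cases "d = 0")
  case False
  then show ?thesis
    using involution_fixed assms by blast
qed simp

lemma n_involution [simp]: "d \<noteq> 0 \<Longrightarrow> d + d = 0 \<Longrightarrow> n d d = d"
  by (simp add: involution_fixed)

lemma involution_minus: "d + d = 0 \<Longrightarrow> - d = (d :: 'u)"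
  by (simp add: minus_unique)

lemma involution_diff: "d + d = 0 \<Longrightarrow> w - d = w + (d :: 'u)"
  by (metis diff_conv_add_uminus involution_minus)

lemma involution_add: "d + d = (0 :: 'u) \<Longrightarrow> e + e = 0 \<Longrightarrow> (d + e) + (d + e) = 0"
proof -
  assume d: "d + d = 0" and e: "e + e = 0"
  have "(d + e) + (d + e) = d + (e + d) + e"
    by (simp add: add.assoc)
  also have "e + d = d + e"
    by (rule involution_commute[OF e])
  also have "d + (d + e) + e = (d + d) + (e + e)"
    by (simp only: add.assoc)
  finally show ?thesis
    using d e by simp
qed

text \<open>As \<open>n e\<close> fixes the involution \<open>e\<close>, \<open>n x e\<close> is the
  image of \<open>e\<close> under the additive Hua map \<open>n x \<circ> n e\<close>.\<close>

lemma n_double_0: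
  assumes "x \<noteq> 0" "e + e = 0"
  shows "n x e + n x e = 0"
proof (cases "e = 0")
  case False
  then show ?thesis
    using hua_add[OF assms(1) False, of e e] assms False by (simp add: n_zero)
qed (simp add: n_zero assms)

lemma n_double_0_iff [simp]: "x \<noteq> 0 \<Longrightarrow> n x e + n x e = 0 \<longleftrightarrow> e + e = 0"
  by (metis n_double_0 n_n)

text \<open>This is \<open>n_hua\<close> at \<open>w = n y y\<close>, where \<open>n_self\<close>
  turns \<open>n w\<close> into \<open>n y\<close>.\<close>

lemma n_conj:
  assumes "x \<noteq> 0" "y \<noteq> 0"
  shows "n (n x y) u = n x (n y (n x u))"
  using n_hua[of x y "n y y" u] assms by (simp add: n_self)

text \<open>For a second fixed point \<open>w\<close>, \<open>n_add\<close> gives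
  \<open>n e (w + e) = n e (w - e) + e\<close>, and \<open>w - e = w + e\<close> would force
  \<open>e = 0\<close>.\<close>

lemma fixed_unique:
  assumes "e \<noteq> 0" "e + e = 0" "w \<noteq> 0" "n e w = w"
  shows "w = e"
proof (rule ccontr)
  assume "w \<noteq> e"
  then have "w + e \<noteq> 0"
    using assms by (metis add_right_cancel)
  then have "n e (w + e) = n e (w + e) + e"
    using n_add[of e w] assms by (simp add: involution_minus involution_diff)
  then show False
    using assms(1) by (metis add_0_right add_left_cancel)
qed

lemma class_unique:
  assumes "e \<noteq> 0" "e + e = 0" "f \<noteq> 0" "f + f = 0" "n e = n f"
  shows "e = f"
  using fixed_unique[of f e] assms n_involution[of e] by simp

lemma ex_class: "x \<noteq> 0 \<Longrightarrow> \<exists>e. e \<noteq> 0 \<and> e + e = 0 \<and> n e = n x"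
  using ex_fixed by blast

lemma ex_other: "\<exists>b. b \<noteq> 0 \<and> b + b = 0 \<and> b \<noteq> (a :: 'u)"
proof -
  obtain x y where xy: "x \<noteq> 0" "y \<noteq> 0" "n x \<noteq> n y"
    using two_classes by blast
  obtain e where e: "e \<noteq> 0" "e + e = 0" "n e = n x"
    using ex_class[OF xy(1)] by blast
  obtain f where f: "f \<noteq> 0" "f + f = 0" "n f = n y"
    using ex_class[OF xy(2)] by blast
  show ?thesis
  proof (cases "e = a")
    case True
    then show ?thesis
      using f e(3) xy(3) by (intro exI[of _ f]) auto
  qed (use e in blast)
qed

section \<open>Change of base point from \<open>x\<close> to \<open>x + b\<close> for an involution
  \<open>b\<close>\<close>

lemma shift_class_aux:
  assumes x: "x \<noteq> 0" and b: "b \<noteq> 0" "b + b = 0" "x \<noteq> b"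
  shows "n (- n x (- x) + n x b) u = n x (n b (n (x + b) u))"
proof -
  have "b + x \<noteq> 0"
    using b by (metis add_left_cancel)
  moreover have "n x b + - n x (- x) = - n x (- x) + n x b"
    by (rule involution_commute) (simp add: b x)
  moreover have "b + x = x + b"
    by (rule involution_commute) (simp add: b)
  ultimately show ?thesis
    using n_sum[of x b u] x b by simp
qed

lemma minus_class:
  fixes b x :: 'u
  assumes "b + b = 0" "x + b \<noteq> 0"
  shows "n (- x + b) = n (x + b)"
proof -
  have "- (x + b) = - x + b"
    by (metis assms(1) involution_commute involution_minus minus_add)
  then show ?thesis
    using n_minus assms by metis
qed

text \<open>With \<open>z = - n x (- x)\<close>, the changes of base point at \<open>x\<close> by
  \<open>b\<close> and at \<open>- z\<close> by \<open>n x b\<close> cancel once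
  \<open>n (n x b)\<close> is expanded by \<open>n_conj\<close>; the hexagon relation
  \<open>n x z = - n x x\<close> links them.\<close>

lemma n_class:
  assumes x: "x \<noteq> 0" and b: "b + b = 0" "x \<noteq> b"
  shows "n (n x x + b) = n (x + b)"
proof (cases "b = 0")
  case True
  then show ?thesis using x n_self by simp
next
  case False
  define z where "z = - n x (- x)"
  have nz: "n x z = - n x x"
    using n_hexagon x by (simp add: z_def)
  have z0: "- z \<noteq> 0" "n (- z) = n x"
    using x n_self[of "- x"] n_minus[of x] n_minus[of "n x (- x)"] by (auto simp: z_def n_minus)
  have xb: "n x b \<noteq> 0" "n x b + n x b = 0"
    using x False b by auto
  have xb0: "x + b \<noteq> 0"
    using b by (metis add_right_cancel)
  have ne: "- z \<noteq> n x b"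
    using n_inject[of x "- x" b] x b involution_minus by (metis minus_minus z_def)
  have zb0: "z + n x b \<noteq> 0"
    using ne xb by (metis add_eq_0_iff)
  have 1: "n (z + n x b) u = n x (n b (n (x + b) u))" for u
    using shift_class_aux[OF x False b] by (simp add: z_def)
  have 2: "n (- z + n x b) = n (z + n x b)"
    by (rule minus_class[OF xb(2) zb0])
  have "n (n x x + b) u = n x (n (n x b) (n (- z + n x b) u))" for u
    using shift_class_aux[OF z0(1) xb ne, of u] z0 nz x by (simp add: n_minus)
  then have "n (n x x + b) u = n (x + b) u" for u
    using 1 2 x False by (simp add: n_conj)
  then show ?thesis by blast
qed

text \<open>Improves \<open>shift_class_aux\<close>: inside the \<mu>-map,
  \<open>minus_class\<close> and \<open>n_class\<close> at \<open>- x\<close> replace the summand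
  \<open>- n x (- x)\<close> by \<open>x\<close> itself.\<close>

lemma shift_class:
  assumes x: "x \<noteq> 0" and b: "b \<noteq> 0" "b + b = 0" "x \<noteq> b"
  shows "n (x + n x b) u = n x (n b (n (x + b) u))"
proof -
  have xb: "n x b + n x b = 0" 
    using x b by auto
  have ne: "n x (- x) \<noteq> n x b"
    using n_inject[of x "- x" b] x b involution_minus by (metis minus_minus)
  then have ne': "- n x (- x) + n x b \<noteq> 0" "n x (- x) + n x b \<noteq> 0"
    using involution_minus[OF xb] by (metis add.inverse_inverse add_eq_0_iff2)+
  show ?thesis
  proof (cases "x = n x b")
    case True
    then have "x + x = 0" using xb by simp
    then have "n x x = x" using x by simp
    then have "x = b" using True n_inject x by metis
    then show ?thesis using b by simp
  next
    case False
    then have F: "x + n x b \<noteq> 0" "- x + n x b \<noteq> 0"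
      using xb by (metis add_right_cancel, metis add_eq_0_iff neg_equal_iff_equal add.inverse_inverse)
    have m: "-x \<noteq> n x b" using F(1) by (metis add.right_inverse)
    have "n (- n x (- x) + n x b) = n (n x (- x) + n x b)"
      by (rule minus_class[OF xb ne'(2)])
    also have "\<dots> = n (- x + n x b)"
      using n_class[of "- x" "n x b"] x xb m by (simp add: n_minus)
    also have "\<dots> = n (x + n x b)"
      by (rule minus_class[OF xb F(1)])
    finally show ?thesis
      using shift_class_aux[OF x b, of u] by metis
  qed
qed


subsection \<open>Relations between the points \<open>(b \<plusminus> p)\<mu>\<^sub>p\<close>\<close>

lemma double_minus_0_iff: "- x + - x = 0 \<longleftrightarrow> x + x = (0 :: 'u)"
  by (metis minus_add neg_equal_0_iff_equal)

lemma minus_eq_self_iff [simp]: "- x = x \<longleftrightarrow> x + x = (0 :: 'u)"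
  by (metis add.right_inverse minus_unique)

lemma double_add:
  fixes x b :: 'u
  assumes "b + b = 0"
  shows "(x + b) + (x + b) = x + x"
proof -
  have "(x + b) + (x + b) = x + (b + x) + b"
    by (simp only: add.assoc)
  also have "b + x = x + b"
    by (rule involution_commute[OF assms])
  also have "x + (x + b) + b = (x + x) + (b + b)"
    by (simp only: add.assoc)
  finally show ?thesis
    using assms by simp
qed

text \<open>\<open>n_add\<close> at the base point \<open>b\<close>, carried over by the Hua map
  \<open>n a \<circ> n b\<close>; so \<open>b\<close> can be added under a map \<open>n a\<close>
  unrelated to \<open>b\<close>.\<close>

lemma n_add_involution:
  assumes "a \<noteq> 0" "b \<noteq> 0" "b + b = 0" "w \<noteq> 0" "w \<noteq> b"
  shows "n a (w + b) = n a (n b w + b) + n a b"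
proof -
  have "w + b \<noteq> 0"
    using assms by (metis add_right_cancel)
  then have "n b (w + b) = n b (n b w + b) + b"
    using n_add[of b w] assms by (simp add: involution_minus involution_diff)
  then have "n a (n b (n b (w + b))) = n a (n b (n b (n b w + b) + b))"
    by simp
  then show ?thesis
    using assms by (simp add: hua_add)
qed

text \<open>Expands \<open>(\<mu>\<^sub>y y + b)\<mu>\<^sub>y\<close> once by the rule for adding \<open>b\<close> and once by the rule for adding \<open>\<mu>\<^sub>y y\<close>.\<close>

lemma shift_relation:
  assumes y: "y + y \<noteq> 0" and b: "b \<noteq> 0" "b + b = 0"
  shows "n y (n b (n y (y + n y b))) + n y b = n b (- y + b) + b + y"
proof -
  have y0: "y \<noteq> 0"
    using y by auto
  define x where "x = n y y"
  have nx: "n x = n y"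
    using y0 by (simp add: x_def n_self)
  have x: "x + x \<noteq> 0" "x \<noteq> 0"
    using y y0 by (auto simp: x_def)
  define z where "z = - n y (- x)"
  have z: "z + z \<noteq> 0"
    using x y0 by (simp add: z_def double_minus_0_iff)
  have nz: "n y z = - y"
    using n_hexagon[OF x(2)] y0 by (simp add: nx z_def) (simp add: x_def)
  have b': "n y b \<noteq> 0" "n y b + n y b = 0"
    using b y0 by auto
  have xb: "x \<noteq> b" "z \<noteq> n y b" "z \<noteq> 0"
    using x z b b' by auto
  have "n b x + b = n b (n y (y + n y b))"
    using b y0 by (simp add: x_def hua_add)
  then have 1: "n y (x + b) = n y (n b (n y (y + n y b))) + n y b"
    using n_add_involution[OF y0 b x(2) xb(1)] by simp
  have "b + x \<noteq> 0"
    using b xb by (metis add_left_cancel)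
  then have "n y (b + x) = n y (n y b - n y (- x)) + y"
    using n_add[of x b] x b y0 by (simp add: nx) (simp add: x_def)
  also have "n y b - n y (- x) = z + n y b"
    using involution_commute[OF b'(2), of z] by (simp add: z_def)
  also have "n y (z + n y b) = n y (n (n y b) z + n y b) + b"
    using n_add_involution[OF y0 b' xb(3,2)] y0 by simp
  also have "n (n y b) z + n y b = n y (n b (- y + b))"
    using b y0 hua_add[OF y0 b(1), of "- y" b] by (simp add: n_conj nz)
  finally have "n y (b + x) = n b (- y + b) + b + y"
    using y0 by simp
  then show ?thesis
    using 1 involution_commute[OF b(2), of x] by simp
qed

text \<open>Obtained from \<open>shift_relation\<close> at \<open>- p\<close>: the Hua map
  \<open>n b \<circ> n p\<close> strips the outer maps off \<open>n p (- p + n p b)\<close>, which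
  is then isolated.\<close>

lemma shift_minus:
  assumes p: "p + p \<noteq> 0" and b: "b \<noteq> 0" "b + b = 0"
  shows "n p (n p b - p) = n b (n p (n b (b + p))) - n b (n p p) + (n b (n p b) + b)"
proof -
  have p0: "p \<noteq> 0"
    using p by auto
  have "n p (n b (n p (- p + n p b))) + n p b = n b (p + b) + b + - p"
    using shift_relation[of "- p" b] p b p0 by (simp add: double_minus_0_iff n_minus)
  then have "n b (n p (n p (n b (n p (- p + n p b))) + n p b)) = n b (n p (n b (p + b) + b + - p))"
    by (rule arg_cong)
  also have "n b (n p (n p (n b (n p (- p + n p b))) + n p b)) = n p (- p + n p b) + b"
    by (subst hua_add) (use b p0 in simp_all)
  also have "n b (n p (n b (p + b) + b + - p)) =
      n b (n p (n b (p + b))) + n b (n p b) - n b (n p p)"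
    by (subst hua_add, (simp add: b p0)+, subst hua_add) (use b p0 in \<open>simp_all add: hua_minus\<close>)
  finally have "n p (- p + n p b) + b = n b (n p (n b (p + b))) + n b (n p b) - n b (n p p)" .
  then have "n p (- p + n p b) = n b (n p (n b (p + b))) + n b (n p b) - n b (n p p) + b"
    using b by (metis add_diff_cancel involution_diff)
  moreover have "- p + n p b = n p b - p"
    using involution_commute[of "n p b" "- p"] p0 b by simp
  moreover have "p + b = b + p"
    using involution_commute[of b p] b by simp
  moreover have "n b (n p b) - n b (n p p) = - n b (n p p) + n b (n p b)"
    using involution_commute[of "n b (n p b)" "- n b (n p p)"] p0 b by simp
  ultimately show ?thesis
    by (simp add: add_diff_eq[symmetric]) (simp add: add.assoc diff_conv_add_uminus del: add_uminus_conv_diff)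
qed

text \<open>\<open>n_add\<close> at the base point \<open>- p\<close>; it evaluates the same point
  as \<open>shift_minus\<close> in a second way.\<close>

lemma hexagon_shift:
  assumes p: "p + p \<noteq> 0" and b: "b \<noteq> 0" "b + b = 0"
  shows "n p (n p b - p) = n p (b - n p p) + n p (- p)"
proof -
  have p0: "p \<noteq> 0"
    using p by auto
  have "n p b \<noteq> p"
    using p b p0 by (metis n_double_0_iff)
  then show ?thesis
    using n_add[of "- p" "n p b"] b p0 by (simp add: n_minus)
qed

text \<open>The case \<open>b = a\<close> of \<open>shift_minus\<close>: every \<open>n b\<close>
  equals \<open>n p\<close>, so the composites collapse and the last bracket becomes
  \<open>a + a\<close>.\<close>

lemma class_shift_minus:
  assumes "p + p \<noteq> 0" "a \<noteq> 0" "a + a = 0" "n a = n p"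
  shows "n p (a - p) = n p (a + p) - p"
proof -
  have "p \<noteq> 0" "n p a = a"
    using assms n_involution[of a] by auto
  then show ?thesis
    using shift_minus[of p a] assms by simp
qed

lemma n_hexagon': "x \<noteq> 0 \<Longrightarrow> n x (- n x x) = - n x (- x)"
  by (metis n_hexagon n_n)

lemma hexagon_step:
  assumes "p + p \<noteq> 0" "a \<noteq> 0" "a + a = 0" "n a = n p"
  shows "n p (a - n p p) = n p (a + p) - p - n p (- p)"
  using class_shift_minus[OF assms] hexagon_shift[OF assms(1-3)] n_involution[OF assms(2,3)] assms(4)
  by (simp add: eq_diff_eq)

text \<open>With \<open>q = - n p p\<close> and \<open>r = n p (- p)\<close>,
  \<open>hexagon_step\<close> leads from \<open>a + p\<close> to \<open>a + q\<close>, then to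
  \<open>a + r\<close> and back to \<open>a + p\<close>; the terms collected on the way must
  cancel.\<close>

lemma hexagon_sum:
  assumes p: "p + p \<noteq> 0"
  shows "- n p p + n p (- p) + p + (- n p p + n p (- p) + p) = 0"
proof -
  have p0: "p \<noteq> 0"
    using p by auto
  obtain a where a: "a \<noteq> 0" "a + a = 0" "n a = n p"
    using ex_class[OF p0] by blast
  define q r where "q = - n p p" and "r = n p (- p)"
  have q: "q + q \<noteq> 0" "n q = n p"
    using p p0 n_self[of p] n_minus[of "n p p"] by (auto simp: q_def double_minus_0_iff)
  have r: "r + r \<noteq> 0" "n r = n p"
    using p p0 n_self[of "- p"] n_minus[of p] by (auto simp: r_def double_minus_0_iff)
  have 1: "n p (a + q) = n p (a + p) - p - r"
    using hexagon_step[OF p a] by (simp add: q_def r_def)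
  have 2: "n p (a + r) = n p (a + q) - q - p"
    using hexagon_step[of q a] q a p0 n_hexagon'[OF p0] by (simp add: q_def r_def)
  have 3: "n p (a + p) = n p (a + r) - r - q"
    using hexagon_step[of r a] r a p0 n_hexagon[OF p0] by (simp add: q_def r_def)
  have "n p (a + p) = n p (a + p) - p - r - q - p - r - q"
    using 1 2 3 by simp
  also have "\<dots> = n p (a + p) + (- p - r - q - p - r - q)"
    by (simp only: diff_conv_add_uminus add.assoc)
  finally have "- p - r - q - p - r - q = 0"
    by (metis add_0_right add_left_cancel)
  then have "- (- p - r - q - p - r - q) = 0"
    by simp
  then show ?thesis
    by (simp add: q_def[symmetric] r_def[symmetric] diff_conv_add_uminus minus_add add.assoc del: add_uminus_conv_diff)
qed


subsection \<open>The center\<close>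

lemma hua_group_center:
  assumes "x \<noteq> 0" "y \<noteq> 0" "p \<in> group_center"
  shows "n x (n y p) \<in> group_center"
proof -
  have "n x (n y p) + w = w + n x (n y p)" for w
  proof -
    have "n x (n y (p + n y (n x w))) = n x (n y (n y (n x w) + p))"
      using assms(3) by (simp add: group_center_def)
    then show ?thesis
      using assms by (simp add: hua_add)
  qed
  then show ?thesis
    unfolding group_center_def by blast
qed

lemma center_add:
  fixes p q :: 'u
  assumes "p \<in> group_center" "q \<in> group_center"
  shows "p + q \<in> group_center"
proof -
  have "p + q + w = w + (p + q)" for w
  proof -
    have "p + q + w = p + (q + w)"
      by (simp only: add.assoc)
    also have "q + w = w + q"
      using assms by (simp only: group_center_def mem_Collect_eq)
    also have "p + (w + q) = p + w + q"
      by (simp only: add.assoc)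
    also have "p + w = w + p"
      using assms by (simp only: group_center_def mem_Collect_eq)
    finally show ?thesis
      by (simp only: add.assoc)
  qed
  then show ?thesis
    by (simp only: group_center_def mem_Collect_eq) blast
qed

lemma involution_center: "b + b = (0 :: 'u) \<Longrightarrow> b \<in> group_center"
  unfolding group_center_def using involution_commute by blast

lemma center_commute: "p \<in> group_center \<Longrightarrow> p + w = w + (p :: 'u)"
  unfolding group_center_def by blast

lemma center_minus:
  fixes p :: 'u
  assumes "p \<in> group_center"
  shows "- p \<in> group_center"
proof -
  have "- p + w = w + - p" for w
    using center_commute[OF assms, of "- w"] by (metis minus_add minus_minus)
  then show ?thesis
    unfolding group_center_def by blast
qed

lemma center_double_add:
  assumes "z \<in> group_center"
  shows "(w + z) + (w + z) = (w + w) + (z + (z :: 'u))"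
proof -
  have "(w + z) + (w + z) = w + (z + w) + z"
    by (simp only: add.assoc)
  also have "z + w = w + z"
    by (rule center_commute[OF assms])
  also have "w + (w + z) + z = (w + w) + (z + z)"
    by (simp only: add.assoc)
  finally show ?thesis .
qed

lemma center_hexagon_sum:
  assumes p: "p + p \<noteq> 0" "p \<in> group_center"
  shows "(- n p p + n p (- p)) + (- n p p + n p (- p)) = - (p + p)"
  using hexagon_sum[OF p(1)] center_double_add[OF p(2)] by (simp add: eq_neg_iff_add_eq_0)

text \<open>Compares \<open>center_hexagon_sum\<close> at the central points \<open>p + b\<close>
  and \<open>p + n p b\<close>, whose doubles are both \<open>p + p\<close>; the link is
  \<open>shift_minus\<close> at \<open>p\<close> and at \<open>- p\<close>.\<close>

lemma center_class_relation:
  assumes p: "p + p \<noteq> 0" "p \<in> group_center" and b: "b \<noteq> 0" "b + b = 0"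
  shows "n p (n (p + b) (p + p)) + n b (n (p + b) (p + p)) = (p + p) + (p + p)"
proof -
  define t u k m where "t = n p" and "u = n (p + b)" and "k = (\<lambda>w. n b (n p w))" and "m = (\<lambda>w. n p (n b w))"
  define P where "P = p + p"
  have p0: "p \<noteq> 0" "p + b \<noteq> 0" "p \<noteq> b"
    using p b double_add[OF b(2), of p] by auto
  have b': "n p b \<noteq> 0" "n p b + n p b = 0"
    using b p0 by auto
  have k_add: "k (v + w) = k v + k w" and k_minus: "k (- v) = - k v" for v w
    using hua_add[OF b(1) p0(1)] hua_minus[OF b(1) p0(1)] by (auto simp: k_def)
  have m_add: "m (v + w) = m v + m w" and mk: "m (k w) = w" for v w
    using hua_add[OF p0(1) b(1)] p0 b by (auto simp: k_def m_def)
  have kp: "k p \<in> group_center"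
    using hua_group_center p b p0 by (auto simp: k_def)
  define z where "z = k b + b"
  have z: "z + z = 0"
    unfolding z_def by (rule involution_add) (use b p0 in \<open>simp_all add: k_def\<close>)
  have minus_add_involution: "- (x + d) = - x + d" if "d + d = 0" for x d :: 'u
    using that by (metis involution_commute involution_minus minus_add)
  \<comment> \<open>\<open>D\<close> is the hexagon difference at \<open>p + b\<close>, carried by
    the Hua map \<open>n p \<circ> n (p + b)\<close>, which undoes the inner
    \<open>n (p + b)\<close>. \<open>D'\<close> is its analogue at \<open>p + n p b\<close>.\<close>
  define X Y D where "X = n p (p + b)" and "Y = n p (- p + b)" and "D = - X + Y"
  define X' Y' D' where "X' = n p (p + n p b)" and "Y' = n p (- p + n p b)" and "D' = - X' + Y'"
  have D: "D + D = - t (u P)"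
  proof -
    have "(p + b) + (p + b) = P" "- (p + b) = - p + b"
      using double_add[OF b(2)] minus_add_involution[OF b(2)] by (auto simp: P_def)
    moreover have "p + b \<in> group_center"
      by (intro center_add p involution_center b)
    ultimately have "(- u (p + b) + u (- p + b)) + (- u (p + b) + u (- p + b)) = - P"
      using center_hexagon_sum[of "p + b"] p by (simp add: P_def u_def)
    then have "t (u ((- u (p + b) + u (- p + b)) + (- u (p + b) + u (- p + b)))) = t (u (- P))"
      by simp
    then show ?thesis
      using p0 by (simp add: t_def u_def hua_add hua_minus X_def Y_def D_def
          del: add_uminus_conv_diff uminus_add_conv_diff)
  qed
  have nu': "n (p + n p b) w = n p (n b (n (p + b) w))" for w
    by (rule shift_class) (use p0 b in auto)
  have D': "D' + D' = - n b (u P)"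
  proof -
    have *: "(p + n p b) + (p + n p b) = P" "- (p + n p b) = - p + n p b"
      using double_add[OF b'(2)] minus_add_involution[OF b'(2)] by (auto simp: P_def)
    have "p + n p b \<noteq> 0"
      using *(1) p by (auto simp: P_def)
    moreover define v where "v = n (p + n p b)"
    moreover have "p + n p b \<in> group_center"
      by (intro center_add p involution_center b')
    ultimately have "(- v (p + n p b) + v (- p + n p b)) + (- v (p + n p b) + v (- p + n p b)) = - P"
      using center_hexagon_sum[of "p + n p b"] p * by (simp add: P_def)
    then have "t (v ((- v (p + n p b) + v (- p + n p b)) + (- v (p + n p b) + v (- p + n p b)))) = t (v (- P))"
      by simp
    then have "D' + D' = - t (v P)"
      using p0 \<open>p + n p b \<noteq> 0\<close> by (simp add: t_def v_def hua_add hua_minus X'_def Y'_def D'_def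
          del: add_uminus_conv_diff uminus_add_conv_diff)
    then show ?thesis
      using nu' p0 by (simp add: t_def v_def u_def)
  qed
  \<comment> \<open>\<open>Y'\<close> comes from \<open>X\<close> and \<open>X'\<close> from
    \<open>Y\<close>, so \<open>D'\<close> will involve \<open>- D\<close>.\<close>
  have Y': "Y' = k (k X) - k p + z"
    using shift_minus[OF p(1) b] p0 involution_commute[OF b(2), of p] involution_commute[OF b'(2), of "- p"]
    by (simp add: X_def Y'_def k_def z_def)
  have X': "X' = k (k Y) + k p + z"
    using shift_minus[of "- p", OF _ b] p p0 involution_commute[OF b(2), of "- p"]
      involution_commute[OF b'(2), of p] k_minus[of p]
    by (simp add: Y_def X'_def k_def z_def n_minus)
  have "D' = k (k (- Y + X)) - (k p + k p)"
  proof -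
    have "D' = - z + - k p + - k (k Y) + k (k X) + - k p + z"
      by (simp add: D'_def X' Y' minus_add add.assoc del: add_uminus_conv_diff)
        (simp add: add.assoc diff_conv_add_uminus del: add_uminus_conv_diff)
    also have "\<dots> = - z + (- k p + (- k (k Y) + k (k X) + - k p)) + z"
      by (simp only: add.assoc)
    also have "- z + (- k p + (- k (k Y) + k (k X) + - k p)) =
        - k p + (- k (k Y) + k (k X) + - k p) + - z"
      by (rule center_commute[OF center_minus[OF involution_center[OF z]]])
    also have "\<dots> + z = - k p + (- k (k Y) + k (k X) + - k p)"
      by (rule diff_add_cancel[unfolded diff_conv_add_uminus])
    also have "\<dots> = (- k (k Y) + k (k X) + - k p) + - k p"
      by (rule center_commute[OF center_minus[OF kp]])
    also have "\<dots> = k (k (- Y + X)) + (- k p + - k p)"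
      by (simp only: k_add k_minus add.assoc)
    finally show ?thesis
      by (simp add: minus_add diff_conv_add_uminus del: add_uminus_conv_diff)
  qed
  also have "- Y + X = - D"
    by (simp add: D_def minus_add)
  finally have D'_eq: "D' = - k (k D) + - k P"
    by (simp add: k_minus P_def k_add)
  have "- k P \<in> group_center"
    by (auto simp: P_def k_add intro!: center_minus center_add kp)
  then have "D' + D' = (- k (k D) + - k (k D)) + (- k P + - k P)"
    unfolding D'_eq by (rule center_double_add)
  also have "- k (k D) + - k (k D) = - k (k (D + D))"
    by (simp only: k_add minus_add)
  also have "\<dots> = k (k (t (u P)))"
    by (simp add: D k_minus)
  also have "\<dots> = k (n b (u P))"
    using p0 by (simp add: k_def t_def)
  finally have "- n b (u P) + (k P + k P) = k (n b (u P)) + (- k P + - k P) + (k P + k P)"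
    using D' by simp
  also have "\<dots> = k (n b (u P))"
    by (simp add: add.assoc diff_conv_add_uminus del: add_uminus_conv_diff)
  finally have "k P + k P = n b (u P) + k (n b (u P))"
    by (metis add.assoc add.right_inverse add_0_left)
  \<comment> \<open>The inverse \<open>m\<close> of the Hua map \<open>k\<close> turns the two
    summands on the right into \<open>n p (u P)\<close> and \<open>n b (u P)\<close>.\<close>
  then have "m (k (P + P)) = m (n b (u P) + k (n b (u P)))"
    by (simp add: k_add)
  then have "P + P = n p (u P) + n b (u P)"
    unfolding mk m_add using b by (simp add: m_def)
  then show ?thesis
    by (simp add: P_def u_def)
qed


lemma center_double:
  assumes p: "p \<in> group_center"
  shows "p + p = (0 :: 'u)"
proof (rule ccontr)
  assume pp: "p + p \<noteq> 0"
  then have p0: "p \<noteq> 0"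
    by auto
  obtain a where a: "a \<noteq> 0" "a + a = 0" "n a = n p"
    using ex_class[OF p0] by blast
  define t P where "t = n p" and "P = p + p"
  have P: "P \<noteq> 0" "t (t w) = w" for w
    using pp p0 by (auto simp: P_def t_def)
  have rel: "n (p + w) (n (p + w + e) P) + n e (n (p + w + e) P) = P + P"
    if "w + w = 0" "e \<noteq> 0" "e + e = 0" for w e
    using center_class_relation[of "p + w" e] that pp p
    by (simp add: P_def double_add center_add involution_center)
  have rel0: "n (p + e) (t P) + n e (t P) = P + P" if "e \<noteq> 0" "e + e = 0" for e
    using rel[of e e] that by (simp add: add.assoc t_def)
  have "n (p + a) (t P) = P"
    using rel0[of a] a P by (simp add: t_def)
  moreover have "p + a \<noteq> 0"
    using double_add[OF a(2), of p] pp by auto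
  ultimately have pa: "n (p + a) P = t P"
    by (metis n_n)
  \<comment> \<open>\<open>rel\<close> at \<open>w = a + e\<close> and \<open>rel0\<close> at
    \<open>a + e\<close> share the summand \<open>n (p + (a + e)) (t P)\<close>, because
    \<open>n (p + a) P = t P\<close>.\<close>
  have eq: "n e (t P) = n (a + e) (t P)" if e: "e \<noteq> 0" "e + e = 0" "e \<noteq> a" for e
  proof -
    have ae: "a + e \<noteq> 0" "(a + e) + (a + e) = 0"
      using a e involution_add by (metis add_left_cancel, blast)
    have "p + (a + e) + e = p + a"
      using e by (simp add: add.assoc)
    then have "n (p + (a + e)) (t P) + n e (t P) = P + P"
      using rel[of "a + e" e] ae e pa by simp
    then show ?thesis
      using rel0[OF ae] by (metis add_left_cancel)
  qed
  have fixed: "n b (t P) = P" if b: "b \<noteq> 0" "b + b = 0" for b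
  proof (cases "b = a")
    case True
    then show ?thesis
      using a P by (simp add: t_def)
  next
    case False
    \<comment> \<open>Chosen so that \<open>a + n a e = b\<close>: \<open>shift_class\<close> then
      writes \<open>n b\<close> as \<open>n a \<circ> n e \<circ> n (a + e)\<close>, and by
      \<open>eq\<close> the last two maps cancel on \<open>t P\<close>.\<close>
    define e where "e = n a (a + b)"
    have ab: "a + b \<noteq> 0" "(a + b) + (a + b) = 0"
      using a b False involution_add by (metis add_left_cancel, blast)
    have e: "e \<noteq> 0" "e + e = 0" "n a e = a + b"
      using a ab p0 by (auto simp: e_def)
    have ea: "e \<noteq> a"
    proof
      assume "e = a"
      then have "a + b = a"
        using e(3) n_involution[OF a(1,2)] by simp
      then show False
        using b by (metis add_0_right add_left_cancel)
    qed
    have "a + (a + b) = b"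
      using a by (metis add.assoc add_0_left)
    then have "n b (t P) = n a (n e (n (a + e) (t P)))"
      using shift_class[of a e "t P"] a e ea by simp
    also have "\<dots> = P"
      using eq[OF e(1,2) ea, symmetric] e(1) a P by (simp flip: t_def)
    finally show ?thesis .
  qed
  obtain f where f: "f \<noteq> 0" "f + f = 0" "n f = n P"
    using ex_class[OF P(1)] by blast
  \<comment> \<open>The Hua map \<open>n b \<circ> t\<close> fixes \<open>P\<close>, so by
    \<open>n_hua\<close> it preserves the class of \<open>P\<close>, whose only involution is
    \<open>f\<close>.\<close>
  have nbf: "n b (t f) = f" if b: "b \<noteq> 0" "b + b = 0" for b
  proof -
    have "n (n b (t f)) w = n (n b (t P)) w" for w
      using n_hua[of b p f w] n_hua[of b p P w] b p0 f P by (simp add: t_def)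
    then have "n (n b (t f)) = n f"
      using fixed[OF b] f by auto
    moreover have "n b (t f) \<noteq> 0" "n b (t f) + n b (t f) = 0"
      using b f p0 by (auto simp: t_def)
    ultimately show ?thesis
      using class_unique f by blast
  qed
  have "t f = f"
    using nbf[OF f(1,2)] n_involution[OF f(1,2)] n_inject[OF f(1), of "t f" f] by simp
  then have "f = a"
    using fixed_unique[OF a(1,2) f(1)] a(3) by (simp add: t_def)
  obtain b where b: "b \<noteq> 0" "b + b = 0" "b \<noteq> a"
    using ex_other by blast
  then show False
    using nbf[OF b(1,2)] \<open>t f = f\<close> \<open>f = a\<close> fixed_unique[OF b(1,2) a(1)] by auto
qed

subsection \<open>The second center\<close>

text \<open>Let \<open>s = p + p\<close> and \<open>c = n p s\<close>. As
  \<open>p + s = - p\<close>, \<open>shift_class\<close> gives \<open>n (p + c) = n c\<close>; hence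
  \<open>class_shift_minus\<close> applies at \<open>p + c\<close> with the involution
  \<open>c\<close>, and \<open>n p \<circ> n c\<close> carries the result back.\<close>

lemma double_class_relation:
  assumes s: "p + p \<noteq> 0" "(p + p) + (p + p) = 0"
  shows "- n p p + n p (- p) = - (p + p + n (p + p) (n p p))"
proof -
  define t where "t = n p"
  define s where "s = p + p"
  define c where "c = t s"
  have p0: "p \<noteq> 0"
    using s by auto
  have s': "s \<noteq> 0" "s + s = 0" "p \<noteq> s"
    using assms p0 by (auto simp: s_def)
  have c: "c \<noteq> 0" "c + c = 0"
    using s' p0 by (auto simp: c_def t_def)
  have ps: "p + s = - p"
    using s' by (simp add: s_def eq_neg_iff_add_eq_0 add.assoc)
  have nc: "n c w = t (n s (t w))" for w
    using s' p0 by (simp add: c_def t_def n_conj)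
  have "n (p + c) w = n c w" for w
    using shift_class[OF p0 s', of w] p0 by (simp add: nc ps n_minus t_def[symmetric] c_def[symmetric])
  then have q: "n c = n (p + c)"
    by auto
  have "(p + c) + (p + c) \<noteq> 0"
    using double_add[OF c(2)] s by simp
  then have "n c (c - (p + c)) = n c (c + (p + c)) - (p + c)"
    using class_shift_minus[of "p + c" c] c q by simp
  moreover have "c - (p + c) = - p"
    by (simp add: diff_conv_add_uminus minus_add del: add_uminus_conv_diff) 
  moreover have "c + (p + c) = p"
    using involution_commute[OF c(2), of "p + c"] c by (simp add: add.assoc)
  ultimately have "t (n c (n c (- p))) = t (n c (n c p - (p + c)))"
    by simp
  also have "\<dots> = t (n c (n c p)) - t (n c (p + c))"
    unfolding t_def by (rule hua_diff[OF p0 c(1)])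
  also have "t (n c (p + c)) = n s (t (p + c))"
    using p0 by (simp add: nc t_def)
  also have "\<dots> = n s (t p) + s"
    using hua_add[OF s'(1) p0, of p c] s' p0 by (simp add: t_def c_def)
  finally have "t (- p) = t p - (n s (t p) + s)"
    using c by simp
  then have "- t p + t (- p) = - (n s (t p) + s)"
    by (simp add: diff_conv_add_uminus del: add_uminus_conv_diff)
  then show ?thesis
    using involution_commute[OF s'(2), of "n s (t p)"] by (simp add: t_def s_def)
qed

text \<open>Constructs a second point \<open>q\<close> with \<open>q + q = p + p\<close> to which
  \<open>double_class_relation\<close> also applies. Doubling the outcome shows that the Hua map
  \<open>k\<close> fixes \<open>s = p + p\<close>; since \<open>n s\<close> fixes \<open>s\<close>,
  so does \<open>n p\<close>.\<close>

lemma double_eq_class: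
  assumes s: "p + p \<noteq> 0" "(p + p) + (p + p) = 0"
    and comm: "\<And>w. (- p + - w + p + w) + (- p + - w + p + w) = 0"
  shows "n p (p + p) = p + p"
proof -
  define t where "t = n p"
  define s where "s = p + p"
  define c where "c = t s"
  define k where "k = (\<lambda>w. n s (t w))"
  have p0: "p \<noteq> 0"
    using s by auto
  have s': "s \<noteq> 0" "s + s = 0" "p \<noteq> s"
    using assms p0 by (auto simp: s_def)
  have c: "c \<noteq> 0" "c + c = 0" "t c = s"
    using s' p0 by (auto simp: c_def t_def)
  have ps: "p + s = - p" "s - p = p" "s + p = - p"
    using s' by (simp_all add: s_def eq_neg_iff_add_eq_0 add.assoc)
  have nc: "n c w = t (n s (t w))" for w
    using s' p0 by (simp add: c_def t_def n_conj)
  have tk: "t (k w) = n c w" for w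
    by (simp add: nc k_def)
  have k_add: "k (v + w) = k v + k w" and k_minus: "k (- v) = - k v" for v w
    using hua_add[OF s'(1) p0] hua_minus[OF s'(1) p0] by (auto simp: k_def t_def)
  have k_inv: "k (t (n s w)) = w" for w
    using s' p0 by (simp add: k_def t_def)
  have k_double: "k w + k w = 0 \<longleftrightarrow> w + w = 0" for w
    using s' p0 by (simp add: k_def t_def)
  define p1 p2 where "p1 = - t p" and "p2 = t (- p)"
  have sum12: "p1 + p2 = - (s + k p)"
    using double_class_relation[OF s] by (simp add: p1_def p2_def t_def s_def k_def)
  \<comment> \<open>The commutator of \<open>k p\<close> and \<open>p1\<close> is the
    \<open>k\<close>-image of a commutator of \<open>p\<close>, so \<open>comm\<close> applies. It
    corrects for swapping \<open>p1\<close> and \<open>p2\<close> in \<open>sum12\<close>.\<close>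
  define d where "d = - k p + - p1 + k p + p1"
  have d: "d + d = 0"
  proof -
    define w where "w = t (n s p1)"
    have "d = k (- p + - w + p + w)"
      unfolding d_def by (simp only: k_add k_minus w_def k_inv)
    then show ?thesis
      using comm k_double by blast
  qed
  \<comment> \<open>\<open>t \<circ> n s\<close> inverts \<open>k\<close>, so
    \<open>k v = s + d\<close>; this turns \<open>- (p2 + p1)\<close> into
    \<open>k (p + v)\<close>.\<close>
  define v where "v = t (n s (s + d))"
  have v: "v + v = 0" "k v = s + d"
    using involution_add[OF s'(2) d] s' p0 by (auto simp: v_def k_inv) (simp add: t_def)
  define q where "q = p + v"
  have sum21: "- (p2 + p1) = k q"
  proof -
    have "- (p2 + p1) = - p1 + - (p1 + p2) + p1"
      by (simp add: minus_add add.assoc)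
    also have "\<dots> = - p1 + (s + k p) + p1"
      by (simp add: sum12)
    also have "\<dots> = (- p1 + s) + (k p + p1)"
      by (simp only: add.assoc)
    also have "- p1 + s = s + - p1"
      using involution_commute[OF s'(2), of "- p1"] by simp
    also have "s + - p1 + (k p + p1) = s + (- p1 + k p + p1)"
      by (simp only: add.assoc)
    also have "- p1 + k p + p1 = k p + d"
      by (simp add: d_def add.assoc diff_conv_add_uminus del: add_uminus_conv_diff)
    also have "s + (k p + d) = (k p + d) + s"
      by (rule involution_commute[OF s'(2)])
    also have "\<dots> = k p + (d + s)"
      by (simp only: add.assoc)
    also have "d + s = s + d"
      by (rule involution_commute[OF d])
    also have "k p + (s + d) = k q"
      by (simp add: q_def k_add v)
    finally show ?thesis .
  qed
  have q: "q + q = s" "q \<noteq> 0"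
    using double_add[OF v(1), of p] s' by (auto simp: q_def s_def)
  have cp1: "c + p1 = n c q"
  proof -
    have "t (s - p) = t (c + p1) + p2"
      using hexagon_shift[OF s(1) c(1,2)] by (simp add: c p1_def p2_def t_def[symmetric])
    then have "t (c + p1) = - (p2 + p1)"
      by (simp add: ps p1_def minus_add eq_diff_eq)
    then have "t (t (c + p1)) = t (k q)"
      using sum21 by simp
    then show ?thesis
      using p0 tk by (simp add: t_def)
  qed
  have cp2: "c - p2 = n c (- q)"
  proof -
    have "t (s + p) = t (c - p2) + t p"
      using hexagon_shift[of "- p" c] s(1) c p0
      by (simp add: n_minus p2_def t_def[symmetric])
    then have "t (c - p2) = p2 + p1"
      by (simp add: ps p1_def p2_def eq_diff_eq)
    then have "t (c - p2) = k (- q)"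
      using sum21 by (simp add: k_minus) (metis minus_minus)
    then have "t (t (c - p2)) = t (k (- q))"
      by simp
    then show ?thesis
      using p0 tk by (simp add: t_def)
  qed
  \<comment> \<open>\<open>c + p1 = n c q\<close> has the \<mu>-map of \<open>p + c\<close>, which
    is \<open>n c\<close>; conjugation by \<open>n c\<close> passes this on to
    \<open>q\<close>.\<close>
  have nq: "n q = n c"
  proof -
    have pc: "p + c \<noteq> 0" "p \<noteq> c"
      using s c double_add[OF c(2), of p] by auto
    have "c + p1 = - t p + c"
      using involution_commute[OF c(2), of p1] by (simp add: p1_def)
    moreover have "t p + c \<noteq> 0"
      using double_add[OF c(2), of "t p"] s p0 by (auto simp: t_def)
    ultimately have "n (c + p1) = n (t p + c)"
      using minus_class[OF c(2), of "t p"] by simp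
    also have "\<dots> = n (p + c)"
      using n_class[OF p0 c(2) pc(2)] by (simp add: t_def)
    also have "n (p + c) w = n c w" for w
      using shift_class[OF p0 s', of w] p0
      by (simp add: nc ps n_minus t_def[symmetric] c_def[symmetric])
    then have "n (p + c) = n c" by auto
    finally have "n (n c q) w = n c w" for w
      by (simp add: cp1)
    then have "n c (n q (n c w)) = n c w" for w
      using n_conj[OF c(1) q(2)] by simp
    then have "n q (n c w) = w" for w
      using n_inject[OF c(1)] by blast
    then have "n q w = n c w" for w
      using c(1) by (metis n_n)
    then show ?thesis by auto
  qed
  have "- n c q + n c (- q) = - (s + n s (n c q))"
    using double_class_relation[of q] q s' nq by simp
  moreover have "n s (n c q) = k (k q)"
    by (simp add: nc k_def)
  moreover have "- n c q + n c (- q) = k q"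
  proof -
    have "- n c q + n c (- q) = - p1 - p2"
      unfolding cp1[symmetric] cp2[symmetric]
      by (simp add: minus_add add.assoc diff_conv_add_uminus del: add_uminus_conv_diff)
    then show ?thesis
      using sum21 by (simp add: minus_add)
  qed
  ultimately have kq: "k q = - (k (k q) + s)"
    using involution_commute[OF s'(2)] by simp
  \<comment> \<open>Doubling \<open>kq\<close> eliminates \<open>q\<close>, as
    \<open>q + q = s\<close> and adding the involution \<open>s\<close> does not change
    doubles.\<close>
  have "k s = k q + k q"
    using q k_add by metis
  also have "\<dots> = - ((k (k q) + s) + (k (k q) + s))"
    using kq by (metis minus_add)
  also have "\<dots> = - (k (k q) + k (k q))"
    by (simp add: double_add[OF s'(2)])
  also have "\<dots> = - k (k s)"
    by (metis k_add q(1))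
  also have "\<dots> = k (k s)"
    using s' by (simp add: k_double)
  finally have "k (k s) = k s"
    by simp
  then have "k s = s"
    using s' p0 by (simp add: k_def t_def) (metis n_inject)
  then have "n s (t s) = n s s"
    using s' by (simp add: k_def)
  then have "t s = s"
    by (rule n_inject[OF s'(1)])
  then show ?thesis
    by (simp add: t_def s_def)
qed

lemma no_proper_second_center:
  fixes p :: 'u
  assumes comm: "\<And>w. - p + - w + p + w \<in> group_center"
  shows "p \<in> group_center"
proof (rule ccontr)
  assume np: "p \<notin> group_center"
  have comm2: "(- p + - w + p + w) + (- p + - w + p + w) = 0" for w
    using center_double comm by blast
  have pp: "p + p \<in> group_center"
  proof -
    have "p + p + w = w + (p + p)" for w
    proof -
      define d where "d = - p + - w + p + w"
      have d: "d + d = 0"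
        using comm2 by (simp add: d_def)
      have "p + w = w + p + d"
        by (simp add: d_def add.assoc diff_conv_add_uminus del: add_uminus_conv_diff)
      then have pw: "p + w = w + p + d" .
      have "p + p + w = p + (w + p + d)"
        unfolding pw[symmetric] by (simp only: add.assoc)
      also have "\<dots> = (p + w) + p + d"
        by (simp only: add.assoc)
      also have "\<dots> = w + p + (d + p) + d"
        unfolding pw by (simp only: add.assoc)
      also have "d + p = p + d"
        by (rule involution_commute[OF d])
      also have "w + p + (p + d) + d = w + (p + p) + (d + d)"
        by (simp only: add.assoc)
      finally show ?thesis
        using d by simp
    qed
    then show ?thesis
      unfolding group_center_def by blast
  qed
  have s: "p + p \<noteq> 0" "(p + p) + (p + p) = 0"
    using np involution_center center_double[OF pp] by blast+
  then have p0: "p \<noteq> 0"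
    by auto
  obtain a where a: "a \<noteq> 0" "a + a = 0" "n a = n p"
    using ex_class[OF p0] by blast
  \<comment> \<open>Adding an involution changes neither \<open>p + p\<close> nor the commutators of
    \<open>p\<close>, so the involution in the class of \<open>q\<close> is again
    \<open>p + p\<close>.\<close>
  have double: "n q = n p" if q: "q = p + b" "b + b = 0" for q b
  proof -
    have qq: "q + q = p + p"
      using q double_add by blast
    have "(- q + - w + q + w) = - p + - w + p + w" for w
    proof -
      have "- q + - w + q + w = - b + (- p + - w + p) + (b + w)"
        by (simp add: q minus_add add.assoc diff_conv_add_uminus del: add_uminus_conv_diff)
      also have "b + w = w + b"
        by (rule involution_commute[OF q(2)])
      also have "- b + (- p + - w + p) + (w + b) = - b + ((- p + - w + p + w) + b)"
        by (simp only: add.assoc)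
      also have "(- p + - w + p + w) + b = b + (- p + - w + p + w)"
        using involution_commute[OF q(2)] by metis
      finally show ?thesis
        by simp
    qed
    then have "n q (q + q) = q + q"
      using double_eq_class[of q] s comm2 qq by simp
    moreover have "n p (p + p) = p + p"
      using double_eq_class s comm2 by blast
    moreover have "q \<noteq> 0"
      using qq s by auto
    then obtain c where c: "c \<noteq> 0" "c + c = 0" "n c = n q"
      using ex_class by blast
    ultimately have "p + p = c" "p + p = a"
      using qq fixed_unique[OF c(1,2) s(1)] fixed_unique[OF a(1,2) s(1)] a by auto
    then show ?thesis
      using c a by simp
  qed
  obtain b where b: "b \<noteq> 0" "b + b = 0" "b \<noteq> a"
    using ex_other by blast
  have "p \<noteq> b"
    using b s by auto
  have "n p b + n p b = 0"
    using b p0 by simp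
  then have "n p w = n p (n b (n p w))" for w
    using shift_class[OF p0 b(1,2) \<open>p \<noteq> b\<close>, of w] double[OF refl b(2)] double[of "p + n p b" "n p b"]
    by simp
  then have "n b (n p w) = w" for w
    using n_inject[OF p0] by metis
  then have "n b w = n p w" for w
    by (metis n_n p0)
  then have "n b = n a"
    using a by auto
  then show False
    using class_unique b a by blast
qed


lemma upper_central_subset_center: "upper_central k \<subseteq> (group_center :: 'u set)"
proof (induction k)
  case 0
  show ?case
    by (auto simp: group_center_def)
next
  case (Suc k)
  show ?case
  proof
    fix p :: 'u
    assume "p \<in> upper_central (Suc k)"
    then have "- p + - w + p + w \<in> group_center" for w
      using Suc.IH by auto
    then show "p \<in> group_center"
      by (rule no_proper_second_center)
  qed
qed

theorem nilpotent_imp_exponent_2: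
  assumes "nilpotent_group TYPE('u)"
  shows "(a :: 'u) + b = b + a" and "a + a = 0"
proof -
  have "a \<in> group_center"
    using assms upper_central_subset_center unfolding nilpotent_group_def by blast
  then show "a + b = b + a" "a + a = 0"
    using center_commute center_double by blast+
qed

end

section \<open>The \<open>\<mu>\<close>-maps of a Moufang set\<close>

lemma alpha_simps [simp]: "alpha a None = None" "alpha a (Some b) = Some (b + a)"
  by (simp_all add: alpha_def)

lemma alpha_alpha [simp]: "alpha a (alpha b z) = alpha (b + a) z"
  by (cases z) (simp_all add: add.assoc)

lemma alpha_0 [simp]: "alpha 0 z = z"
  by (cases z) simp_all

lemma Bij_UNIV: "Bij UNIV = {f. bij f}"
  by (auto simp: Bij_def)

lemma little_projective_group_bij:
  assumes R: "\<And>x. subgroup (R x) (BijGroup UNIV)"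
    and f: "f \<in> little_projective_group R"
  shows "bij f"
proof -
  have "(\<Union>x. R x) \<subseteq> carrier (BijGroup UNIV)"
    using R subgroup.subset by blast
  then have "f \<in> carrier (BijGroup UNIV)"
    using f group.generate_in_carrier[OF group_BijGroup] by (simp add: little_projective_group_def)
  then show ?thesis
    by (simp add: BijGroup_def Bij_UNIV)
qed

lemma little_projective_group_comp:
  assumes R: "\<And>x. subgroup (R x) (BijGroup UNIV)"
    and f: "f \<in> little_projective_group R" "g \<in> little_projective_group R"
  shows "f \<circ> g \<in> little_projective_group R"
proof -
  have "f \<otimes>\<^bsub>BijGroup UNIV\<^esub> g \<in> little_projective_group R"
    using f unfolding little_projective_group_def by (rule generate.eng)
  then show ?thesis
    using little_projective_group_bij[OF R] f
    by (simp add: BijGroup_def Bij_UNIV compose_def comp_def restrict_UNIV)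
qed

lemma root_group_subset: "R x \<subseteq> little_projective_group R"
  unfolding little_projective_group_def by (auto intro: generate.incl)

section \<open>Root groups of \<open>M(U,\<tau>)\<close> and uniqueness of the \<mu>-maps\<close>

locale moufang_construction =
  fixes \<tau> :: "'u::group_add option \<Rightarrow> 'u option"
  assumes tau: "interchanges_0_infinity \<tau>"
    and moufang: "moufang_set (root_groups \<tau>)"
begin

abbreviation \<tau>' :: "'u option \<Rightarrow> 'u option" where
  "\<tau>' \<equiv> inv_into UNIV \<tau>"

text \<open>The conjugate of \<open>alpha c\<close> by \<open>\<tau>\<close>, that is, a general
  element of the root group at \<open>0\<close>.\<close>

definition gam :: "'u \<Rightarrow> 'u option \<Rightarrow> 'u option" where
  "gam c z = \<tau> (alpha c (\<tau>' z))"

lemma tau_simps [simp]: "\<tau> (\<tau>' z) = z" "\<tau>' (\<tau> z) = z"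
    "\<tau> None = Some 0" "\<tau> (Some 0) = None" "\<tau>' None = Some 0" "\<tau>' (Some 0) = None"
proof -
  have b: "bij \<tau>" and t: "\<tau> None = Some 0" "\<tau> (Some 0) = None"
    using tau by (auto simp: interchanges_0_infinity_def)
  show "\<tau> (\<tau>' z) = z" "\<tau>' (\<tau> z) = z" "\<tau> None = Some 0" "\<tau> (Some 0) = None"
    using b t by (simp_all add: bij_is_surj surj_f_inv_f bij_is_inj)
  show "\<tau>' None = Some 0" "\<tau>' (Some 0) = None"
    using b t by (metis bij_is_inj inv_f_f)+
qed

lemma tau_Some: "x \<noteq> 0 \<Longrightarrow> \<tau>' (Some x) = Some (at_U \<tau>' x)"
  using tau_simps(1)[of "Some x"] by (cases "\<tau>' (Some x)") (auto simp: at_U_def)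

lemma gam_gam [simp]: "gam c (gam d z) = gam (d + c) z"
  by (simp add: gam_def)

lemma gam_simps [simp]: "gam c (Some 0) = Some 0" "gam 0 z = z" "gam c None = \<tau> (Some c)"
  by (simp_all add: gam_def)

lemma gam_None_eq: "gam c None = gam d None \<Longrightarrow> c = d"
  by (metis gam_simps(3) option.inject tau_simps(2))

lemma perm_conj_alpha: "perm_conj (alpha c) \<tau> = gam c"
  by (simp add: fun_eq_iff perm_conj_def gam_def)

lemma root_groups_None: "root_groups \<tau> None = range alpha"
  by (simp add: root_groups_def)

lemma root_groups_Some: "root_groups \<tau> (Some a) = range (\<lambda>c. alpha a \<circ> gam c \<circ> alpha (- a))"
proof -
  have "inv_into UNIV (alpha a \<circ> \<tau>) = \<tau>' \<circ> alpha (- a)"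
    by (rule inv_unique_comp) (auto simp: fun_eq_iff)
  then have "perm_conj (alpha c) (alpha a \<circ> \<tau>) = alpha a \<circ> gam c \<circ> alpha (- a)" for c
    by (simp add: fun_eq_iff perm_conj_def gam_def)
  then show ?thesis
    by (auto simp: root_groups_def image_image)
qed

lemma root_groups_0: "root_groups \<tau> (Some 0) = range gam"
proof -
  have "alpha 0 \<circ> gam c \<circ> alpha (- 0) = gam c" for c
    by (simp add: fun_eq_iff)
  then show ?thesis
    by (simp add: root_groups_Some)
qed

lemma root_subgroup: "subgroup (root_groups \<tau> x) (BijGroup UNIV)"
  using moufang by (simp add: moufang_set_def)

abbreviation G :: "('u option \<Rightarrow> 'u option) set" where
  "G \<equiv> little_projective_group (root_groups \<tau>)"

lemmas G_comp = little_projective_group_comp[OF root_subgroup]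
lemmas G_bij = little_projective_group_bij[OF root_subgroup]

lemma alpha_in_G: "alpha a \<in> G"
  using root_group_subset[of "root_groups \<tau>" None] root_groups_None by auto

lemma gam_in_G: "gam a \<in> G"
  using root_group_subset[of "root_groups \<tau>" "Some 0"] root_groups_0 by auto

lemma G_conj: "g \<in> G \<Longrightarrow> u \<in> root_groups \<tau> x \<Longrightarrow> g \<circ> u \<circ> inv_into UNIV g \<in> root_groups \<tau> (g x)"
  using moufang unfolding moufang_set_def perm_conj_def by blast

abbreviation M :: "'u \<Rightarrow> 'u option \<Rightarrow> 'u option" where
  "M \<equiv> mu \<tau>"

lemma M_eq: "M x z = gam (- at_U \<tau>' x) (alpha x (gam (at_U \<tau>' (- x)) z))"
  by (simp add: mu_def perm_conj_alpha)

lemma M_in_G: "M x \<in> G"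
  unfolding mu_def perm_conj_alpha by (intro G_comp gam_in_G alpha_in_G)

lemma M_None: "x \<noteq> 0 \<Longrightarrow> M x None = Some 0"
  by (simp add: M_eq flip: tau_Some)

lemma M_0:
  assumes "x \<noteq> 0"
  shows "M x (Some 0) = None"
proof -
  have "M x (Some 0) = gam (- at_U \<tau>' x) (Some x)"
    by (simp add: M_eq)
  also have "\<dots> = None"
    using assms by (simp add: gam_def tau_Some)
  finally show ?thesis .
qed

text \<open>The image of \<infinity> determines \<open>d\<close> and that of \<open>0\<close>
  determines \<open>c\<close>. Later identities between \<mu>-maps come from exhibiting such a
  factorization.\<close>

lemma M_unique:
  assumes x: "x \<noteq> 0" and f: "f None = Some 0" "f (Some 0) = None"
    and eq: "\<And>z. f z = gam c (alpha x (gam d z))"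
  shows "f = M x"
proof -
  have "gam (- c) (f None) = alpha x (gam d None)"
    by (simp add: eq del: gam_simps(3))
  then have "alpha (- x) (alpha x (gam d None)) = alpha (- x) (Some 0)"
    by (simp only: f gam_simps(1))
  then have "\<tau> (Some d) = \<tau> (\<tau>' (Some (- x)))"
    by simp
  then have "\<tau>' (\<tau> (Some d)) = \<tau>' (Some (- x))"
    by simp
  then have d: "d = at_U \<tau>' (- x)"
    using x by (simp add: tau_Some)
  have "gam (- c) (f (Some 0)) = Some x"
    by (simp add: eq)
  then have "\<tau>' (\<tau> (Some (- c))) = \<tau>' (Some x)"
    by (simp add: f)
  then have "c = - at_U \<tau>' x"
    using x by (simp add: tau_Some) (metis minus_minus)
  then show ?thesis
    using d by (simp add: fun_eq_iff eq M_eq)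
qed

text \<open>Inverting the factorization of \<open>M x\<close> gives one with middle factor
  \<open>alpha (- x)\<close>.\<close>

lemma M_minus:
  assumes x: "x \<noteq> 0"
  shows "M (- x) (M x z) = z"
proof -
  define f where "f = (\<lambda>z. gam (- at_U \<tau>' (- x)) (alpha (- x) (gam (at_U \<tau>' x) z)))"
  have fM: "f (M x z) = z" for z
    by (simp add: f_def M_eq del: gam_simps(3))
  have "f = M (- x)"
  proof (rule M_unique)
    show "f None = Some 0" "f (Some 0) = None"
      using fM[of "Some 0"] fM[of None] x by (simp_all add: M_None M_0)
    show "f z = gam (- at_U \<tau>' (- x)) (alpha (- x) (gam (at_U \<tau>' x) z))" for z
      by (simp add: f_def)
  qed (use x in simp)
  then show ?thesis
    using fM by simp
qed

end

section \<open>Moufang sets whose \<mu>-maps are involutions\<close>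

locale moufang_involutions = moufang_construction \<tau>
  for \<tau> :: "'u::group_add option \<Rightarrow> 'u option" +
  assumes M_M [simp]: "x \<noteq> 0 \<Longrightarrow> M x (M x z) = z"
begin

lemma M_swap [simp]: "x \<noteq> 0 \<Longrightarrow> M x None = Some 0" "x \<noteq> 0 \<Longrightarrow> M x (Some 0) = None"
  by (rule M_None, assumption, rule M_0)

lemma inv_M: "x \<noteq> 0 \<Longrightarrow> inv_into UNIV (M x) = M x"
  by (rule inv_unique_comp) auto

lemma inv_MM: "x \<noteq> 0 \<Longrightarrow> y \<noteq> 0 \<Longrightarrow> inv_into UNIV (M x \<circ> M y) = M y \<circ> M x"
  by (rule inv_unique_comp) auto

text \<open>The default \<open>0\<close> stands for \<infinity>; composites of two maps really do
  return \<open>0\<close> to \<open>0\<close>, so there it gives the true value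
  (\<open>MM_Some\<close>).\<close>

definition n :: "'u \<Rightarrow> 'u \<Rightarrow> 'u" where
  "n x w = (if w = 0 then 0 else the (M x (Some w)))"

lemma M_Some [simp]:
  assumes "x \<noteq> 0" "w \<noteq> 0"
  shows "M x (Some w) = Some (n x w)"
proof -
  have "M x (Some w) \<noteq> None"
    using assms M_M[of x "Some w"] by (metis M_swap(1) option.inject)
  then show ?thesis
    using assms by (auto simp: n_def)
qed

lemma n_nonzero: "x \<noteq> 0 \<Longrightarrow> w \<noteq> 0 \<Longrightarrow> n x w \<noteq> 0"
  by (metis M_M M_Some M_swap(2) option.distinct(1))

lemma n_zero [simp]: "n x 0 = 0"
  by (simp add: n_def)

lemma n_n [simp]: "x \<noteq> 0 \<Longrightarrow> n x (n x w) = w"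
  by (cases "w = 0") (use M_M[of x "Some w"] n_nonzero[of x w] in simp_all)

lemma MM_Some [simp]: "x \<noteq> 0 \<Longrightarrow> y \<noteq> 0 \<Longrightarrow> M x (M y (Some w)) = Some (n x (n y w))"
  by (cases "w = 0") (simp_all add: n_nonzero)

lemma M_eqI: "x \<noteq> 0 \<Longrightarrow> y \<noteq> 0 \<Longrightarrow> n x = n y \<Longrightarrow> M x = M y"
proof
  fix z
  assume "x \<noteq> 0" "y \<noteq> 0" "n x = n y"
  then show "M x z = M y z"
    by (cases z; cases "the z = 0") simp_all
qed

text \<open>\<open>M x\<close> takes \<infinity> to \<open>0\<close>, so it conjugates the root
  group at \<infinity> into that at \<open>0\<close>; the hypothesis compares the images of
  \<infinity>, which determine an element of the latter.\<close>

lemma M_alpha_M: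
  assumes "x \<noteq> 0" "\<tau> (Some d) = M x (Some c)"
  shows "M x (alpha c (M x z)) = gam d z"
proof -
  have "M x \<circ> alpha c \<circ> inv_into UNIV (M x) \<in> range gam"
    using G_conj[OF M_in_G, of "alpha c" None x] assms root_groups_None by (simp add: root_groups_0)
  then obtain d' where d': "M x \<circ> alpha c \<circ> M x = gam d'"
    using assms by (auto simp: inv_M)
  then have "M x (alpha c (M x None)) = gam d' None"
    by (metis comp_apply)
  then have "d' = d"
    using assms by (intro gam_None_eq) simp
  then show ?thesis
    using d' by (metis comp_apply)
qed

lemma ex_gam:
  assumes "x \<noteq> 0"
  shows "\<exists>d. \<forall>z. M x (alpha c (M x z)) = gam d z"
proof -
  have "M x \<circ> alpha c \<circ> inv_into UNIV (M x) \<in> range gam"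
    using G_conj[OF M_in_G, of "alpha c" None x] assms root_groups_None by (simp add: root_groups_0)
  then obtain d' where "M x \<circ> alpha c \<circ> M x = gam d'"
    using assms by (auto simp: inv_M)
  then show ?thesis
    by (metis comp_apply)
qed

text \<open>A Hua map fixes \<infinity>, hence normalizes the root group there; evaluation at
  \<open>0\<close> identifies the conjugate.\<close>

lemma hua_alpha:
  assumes "x \<noteq> 0" "y \<noteq> 0"
  shows "M x (M y (alpha w (M y (M x z)))) = alpha (n x (n y w)) z"
proof -
  let ?k = "M x \<circ> M y"
  have "?k \<circ> alpha w \<circ> inv_into UNIV ?k \<in> root_groups \<tau> (?k None)"
    by (rule G_conj) (auto intro: G_comp M_in_G simp: root_groups_None)
  then obtain w' where w': "?k \<circ> alpha w \<circ> (M y \<circ> M x) = alpha w'"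
    using assms by (auto simp: root_groups_None inv_MM)
  then have *: "M x (M y (alpha w (M y (M x z)))) = alpha w' z" for z
    by (metis comp_apply)
  then show ?thesis
    using *[of "Some 0"] *[of z] assms by simp
qed

lemma hua_gam:
  assumes "x \<noteq> 0" "y \<noteq> 0"
  shows "\<exists>d. \<forall>z. M x (M y (gam c (M y (M x z)))) = gam d z"
proof -
  let ?k = "M x \<circ> M y"
  have "?k \<circ> gam c \<circ> inv_into UNIV ?k \<in> root_groups \<tau> (?k (Some 0))"
    by (rule G_conj) (auto intro: G_comp M_in_G simp: root_groups_0)
  then obtain d where "?k \<circ> gam c \<circ> (M y \<circ> M x) = gam d"
    using assms by (auto simp: root_groups_0 inv_MM)
  then show ?thesis
    by (metis comp_apply)
qed

lemma hua_add:
  assumes "x \<noteq> 0" "y \<noteq> 0"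
  shows "n x (n y (v + w)) = n x (n y v) + n x (n y w)"
proof -
  have "M x (M y (alpha w (M y (M x (M x (M y (Some v))))))) =
      alpha (n x (n y w)) (M x (M y (Some v)))"
    by (rule hua_alpha[OF assms])
  then show ?thesis
    using assms by simp
qed

lemma M_minus_eq: "x \<noteq> 0 \<Longrightarrow> M (- x) = M x"
proof
  fix z
  assume x: "x \<noteq> 0"
  then show "M (- x) z = M x z"
    using M_minus[OF x, of "M x z"] by simp
qed

text \<open>Writes the inverses of the outer factors of \<open>M x\<close> as conjugates of
  translations by \<open>M x\<close>; the second equation inverts the first one taken at
  \<open>- x\<close>.\<close>

lemma gam_at:
  assumes "x \<noteq> 0"
  shows "gam (at_U \<tau>' x) z = M x (alpha (n x x) (M x z))"
    and "gam (- at_U \<tau>' (- x)) z = M x (alpha (- n x (- x)) (M x z))"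
proof -
  have *: "M x (alpha (n x w) (M x z)) = gam (at_U \<tau>' w) z" if "w \<noteq> 0" for w z
    by (rule M_alpha_M) (use assms that n_nonzero in \<open>auto simp flip: tau_Some\<close>)
  show "gam (at_U \<tau>' x) z = M x (alpha (n x x) (M x z))"
    using * assms by simp
  have "gam (- at_U \<tau>' (- x)) z =
      gam (- at_U \<tau>' (- x)) (M x (alpha (n x (- x)) (M x (M x (alpha (- n x (- x)) (M x z))))))"
    using assms by simp
  also have "\<dots> = M x (alpha (- n x (- x)) (M x z))"
    using *[of "- x"] assms by (simp del: M_M)
  finally show "gam (- at_U \<tau>' (- x)) z = M x (alpha (- n x (- x)) (M x z))" .
qed

lemma alpha_eq: "alpha x z = gam (at_U \<tau>' x) (M x (gam (- at_U \<tau>' (- x)) z))"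
  by (simp add: M_eq del: gam_simps(3))

text \<open>Combines \<open>alpha_eq\<close>, the definition of \<open>M x\<close> solved for
  \<open>alpha x\<close>, with \<open>gam_at\<close>. At points of \<open>U\<close> this yields
  \<open>n_add\<close>, at \<infinity> it yields \<open>n_hexagon\<close>.\<close>

lemma M_alpha:
  assumes "x \<noteq> 0"
  shows "M x (alpha x z) = alpha (n x x) (M x (alpha (- n x (- x)) (M x z)))"
  using assms by (simp add: alpha_eq[of x] gam_at)


lemma n_inject: "x \<noteq> 0 \<Longrightarrow> n x v = n x w \<Longrightarrow> v = w"
  by (metis n_n)

lemma n_add:
  assumes "x \<noteq> 0" "w \<noteq> 0" "w + x \<noteq> 0"
  shows "n x (w + x) = n x (n x w - n x (- x)) + n x x"
proof -
  have "w \<noteq> - x"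
    using assms(3) by auto
  then have "n x w - n x (- x) \<noteq> 0"
    using n_inject[OF assms(1), of w "- x"] by auto
  then show ?thesis
    using M_alpha[of x "Some w"] assms by simp
qed

lemma n_hexagon:
  assumes "x \<noteq> 0"
  shows "n x (- n x (- x)) = - n x x"
proof -
  have "0 = n x (- n x (- x)) + n x x"
    using M_alpha[of x None] assms n_nonzero[of x "- x"] by simp
  then show ?thesis
    by (metis eq_neg_iff_add_eq_0)
qed

text \<open>\<open>M_alpha\<close> factors \<open>M x\<close> with middle factor
  \<open>alpha (n x x)\<close>, once the other two translations are conjugated into the root group
  at \<open>0\<close>.\<close>

lemma n_self:
  assumes x: "x \<noteq> 0"
  shows "M (n x x) = M x"
proof -
  obtain c d where c: "\<And>z. M x (alpha (- x) (M x z)) = gam c z"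
    and d: "\<And>z. M x (alpha (- n x (- x)) (M x z)) = gam d z"
    using ex_gam[OF x] by metis
  have "M x z = gam c (alpha (n x x) (gam d z))" for z
    using x by (simp add: M_alpha[OF x, symmetric] flip: c d)
  from M_unique[OF n_nonzero[OF x x] M_swap[OF x] this] show ?thesis ..
qed

text \<open>A Hua map normalizes both root groups, so it carries the factorization of
  \<open>M w\<close> to one with middle factor \<open>alpha (n x (n y w))\<close>.\<close>

lemma n_hua:
  assumes "x \<noteq> 0" "y \<noteq> 0" "w \<noteq> 0"
  shows "M (n x (n y w)) z = M x (M y (M w (M y (M x z))))"
proof -
  obtain c where c: "\<And>z. M x (M y (gam (- at_U \<tau>' w) (M y (M x z)))) = gam c z"
    using hua_gam assms by metis
  obtain d where d: "\<And>z. M x (M y (gam (at_U \<tau>' (- w)) (M y (M x z)))) = gam d z"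
    using hua_gam assms by metis
  have "M x (M y (M w (M y (M x z)))) = gam c (alpha (n x (n y w)) (gam d z))" for z
    unfolding c[symmetric] d[symmetric] hua_alpha[OF assms(1,2), symmetric] M_eq[of w]
    using assms by (simp del: gam_simps(3))
  then have "(\<lambda>z. M x (M y (M w (M y (M x z))))) = M (n x (n y w))"
    using assms n_nonzero by (intro M_unique[of _ _ c d]) simp_all
  then show ?thesis
    by metis
qed

text \<open>For such \<open>b\<close>, \<open>M_alpha\<close> is a braid relation: the cube of
  \<open>alpha b \<circ> M b\<close> is the identity.\<close>

lemma alpha_fixed:
  assumes b: "b \<noteq> 0" "b + b = 0" "n b b = b"
  shows "alpha b z = M b (alpha b (M b (alpha b (M b z))))"
proof -
  have "- b = b"
    using b(2) by (rule minus_unique)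
  then have "M b (alpha b z) = alpha b (M b (alpha b (M b z)))"
    using M_alpha[OF b(1), of z] b(3) by simp
  then show ?thesis
    using b(1) by (metis M_M)
qed

text \<open>Expanding \<open>alpha x \<circ> alpha b = alpha (b + x)\<close> leaves
  \<open>M w \<circ> M x \<circ> M b\<close> between elements of the root group at \<open>0\<close>,
  where \<open>w = n x b - n x (- x)\<close>; by uniqueness this composite is
  \<open>M (b + x)\<close>.\<close>

lemma n_sum:
  assumes x: "x \<noteq> 0" and b: "b \<noteq> 0" "b + b = 0" "n b b = b" and bx: "b + x \<noteq> 0"
  shows "M (n x b - n x (- x)) z = M x (M b (M (b + x) z))"
proof -
  define y y' w where "y = n x x" and "y' = n x (- x)" and "w = n x b - y'"
  have "b \<noteq> - x"
    using bx by auto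
  then have w: "w \<noteq> 0"
    using n_inject[OF x, of b "- x"] by (auto simp: w_def y'_def)
  obtain u1 where u1: "\<And>z. M x (alpha y (M x z)) = gam u1 z"
    using ex_gam[OF x] by metis
  obtain u2 where u2: "\<And>z. M b (alpha b (M b z)) = gam u2 z"
    using ex_gam[OF b(1)] by metis
  define c d where "c = at_U \<tau>' w" and "d = - at_U \<tau>' (- w)"
  obtain d' where d': "\<And>z. M b (M x (gam d (M x (M b z)))) = gam d' z"
    using hua_gam b(1) x by metis
  have alpha_x: "alpha x z = gam u1 (alpha (- y') (M x z))" for z
    using M_alpha[OF x, of z] x by (simp add: y_def y'_def flip: u1) (metis M_M)
  have hua_b: "M x (M b (alpha b (M b z))) = alpha (n x b) (M x z)" for z
    using hua_alpha[OF x b(1), of b "M x z"] x b by simp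
  have "alpha (b + x) z = gam u1 (gam c (M w (M x (M b (gam d' (gam u2 z))))))" for z
  proof -
    have "alpha b z = M b (alpha b (M b (M b (gam u2 z))))"
      using alpha_fixed[OF b, of z] b(1) by (simp flip: u2)
    then have "alpha (b + x) z = alpha x (M b (alpha b (M b (M b (gam u2 z)))))"
      by (simp only: flip: alpha_alpha)
    also have "\<dots> = gam u1 (alpha w (M x (M b (gam u2 z))))"
      by (simp only: alpha_x hua_b alpha_alpha w_def diff_conv_add_uminus)
    also have "alpha w (M x (M b (gam u2 z))) = gam c (M w (gam d (M x (M b (gam u2 z)))))"
      unfolding c_def d_def by (rule alpha_eq)
    also have "gam d (M x (M b (gam u2 z))) = M x (M b (gam d' (gam u2 z)))"
      unfolding d'[symmetric] using x b(1) by simp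
    finally show ?thesis .
  qed
  from this[of "gam (- u2) (gam (- d') z)" for z]
  have "M w (M x (M b z)) = gam (- u1 - c) (alpha (b + x) (gam (- d' - u2) z))" for z
    by (simp add: diff_conv_add_uminus add.assoc del: gam_simps(3) add_uminus_conv_diff)
  then have "(\<lambda>z. M w (M x (M b z))) = M (b + x)"
    using x b(1) w bx by (intro M_unique[of _ _ "- u1 - c" "- d' - u2"]) simp_all
  then have "M w (M x (M b (M (b + x) z))) = z"
    using M_M[OF bx] by metis
  then have "M w z = M x (M b (M (b + x) z))"
    using M_M[OF w] by metis
  then show ?thesis
    by (simp add: w_def y'_def)
qed

text \<open>If all \<open>\<mu>\<close>-maps equal \<open>t\<close>, then \<open>U\<^sub>\<infinity> \<union> U\<^sub>\<infinity> t U\<^sub>\<infinity>\<close> is closed under composition.\<close>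

lemma sharply_2_transitive_if_constant:
  assumes x: "x \<noteq> 0" and const: "\<And>y. y \<noteq> 0 \<Longrightarrow> M y = M x"
  shows "sharply_2_transitive G"
proof -
  define t where "t = M x"
  have t [simp]: "t (t z) = z" "t None = Some 0" "t (Some 0) = None" for z
    using x by (simp_all add: t_def)
  have t_alpha_t: "\<exists>a b. \<forall>z. t (alpha y (t z)) = alpha a (t (alpha b z))" if "y \<noteq> 0" for y
    using M_alpha[OF that] const[OF that] by (metis t(1) t_def)
  define S where "S f \<longleftrightarrow> (\<exists>a. \<forall>z. f z = alpha a z) \<or> (\<exists>a b. \<forall>z. f z = alpha a (t (alpha b z)))"
    for f :: "'u option \<Rightarrow> 'u option"
  have S1: "S f" if "\<And>z. f z = alpha a z" for f a
    using that S_def by blast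
  have S2: "S f" if "\<And>z. f z = alpha a (t (alpha b z))" for f a b
    using that S_def by blast
  have S3: "S f" if f: "\<And>z. f z = alpha a (t (alpha c (t (alpha b z))))" for f a b c
  proof (cases "c = 0")
    case True
    then show ?thesis
      by (intro S1[of f "b + a"]) (simp add: f)
  next
    case False
    then obtain a' b' where "\<And>z. t (alpha c (t z)) = alpha a' (t (alpha b' z))"
      using t_alpha_t by blast
    then show ?thesis
      by (intro S2[of f "a' + a" "b + b'"]) (simp add: f)
  qed
  have S_comp: "S (f \<circ> g)" if "S f" "S g" for f g
  proof -
    from \<open>S f\<close> consider a where "\<And>z. f z = alpha a z" | a b where "\<And>z. f z = alpha a (t (alpha b z))"
      unfolding S_def by blast
    then show ?thesis
    proof cases
      case f: (1 a)
      from \<open>S g\<close> consider a where "\<And>z. g z = alpha a z" | a b where "\<And>z. g z = alpha a (t (alpha b z))"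
        unfolding S_def by blast
      then show ?thesis
      proof cases
        case (1 a')
        then show ?thesis
          by (intro S1[of _ "a' + a"]) (simp add: f)
      next
        case (2 a' b')
        then show ?thesis
          by (intro S2[of _ "a' + a" b']) (simp add: f)
      qed
    next
      case f: (2 a b)
      from \<open>S g\<close> consider a where "\<And>z. g z = alpha a z" | a b where "\<And>z. g z = alpha a (t (alpha b z))"
        unfolding S_def by blast
      then show ?thesis
      proof cases
        case (1 a')
        then show ?thesis
          by (intro S2[of _ a "a' + b"]) (simp add: f)
      next
        case (2 a' b')
        then show ?thesis
          by (intro S3[of _ a "a' + b" b']) (simp add: f)
      qed
    qed
  qed
  have t_eq_None: "t v = None \<longleftrightarrow> v = Some 0" for v
    by (metis t)
  have S_root: "S f" if f: "f \<in> root_groups \<tau> y" for f y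
  proof (cases y)
    case None
    then show ?thesis
      using f S1 by (auto simp: root_groups_None)
  next
    case (Some a)
    then obtain c where c: "\<And>z. f z = alpha a (gam c (alpha (- a) z))"
      using f by (auto simp: root_groups_Some)
    have "\<tau> (Some c) \<noteq> Some 0"
      by (metis option.distinct(1) tau_simps(2,3))
    then obtain c' where c': "t (\<tau> (Some c)) = Some c'"
      using t_eq_None by (metis not_None_eq)
    then have "\<tau> (Some c) = M x (Some c')"
      by (metis t(1) t_def)
    then have "gam c z = t (alpha c' (t z))" for z
      using M_alpha_M[OF x] by (simp add: t_def)
    then show ?thesis
      by (intro S3[of f a c' "- a"]) (simp add: c)
  qed
  have G_S: "S f" if "f \<in> G" for f
    using that unfolding little_projective_group_def
  proof (induction rule: generate.induct)
    case one
    show ?case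
      by (rule S1[of _ 0]) (simp add: BijGroup_def)
  next
    case (incl h)
    then show ?case
      using S_root by blast
  next
    case (inv h)
    then show ?case
      using S_root subgroup.m_inv_closed[OF root_subgroup] by blast
  next
    case (eng h1 h2)
    then have "bij h1" "bij h2"
      using G_bij by (simp_all add: little_projective_group_def)
    then have *: "h1 \<otimes>\<^bsub>BijGroup UNIV\<^esub> h2 = h1 \<circ> h2"
      by (simp add: BijGroup_def Bij_UNIV compose_def comp_def restrict_UNIV)
    show ?case
      unfolding * using eng.IH by (rule S_comp)
  qed
  \<comment> \<open>The second form in \<open>S\<close> sends \<infinity> into \<open>U\<close>, and
    of the translations only \<open>alpha 0\<close> fixes \<open>0\<close>. Given this, only
    transitivity on pairs (\<open>ex\<close>) remains.\<close>
  have trivial: "f z = z" if "f \<in> G" "f None = None" "f (Some 0) = Some 0" for f z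
    using G_S[OF that(1)] that(2,3) unfolding S_def by auto
  have t_in_G: "t \<in> G"
    unfolding t_def by (rule M_in_G)
  have ex: "\<exists>g g'. g \<in> G \<and> g' \<in> G \<and> (\<forall>z. g (g' z) = z) \<and> (\<forall>z. g' (g z) = z) \<and>
      g None = u \<and> g (Some 0) = v" if "u \<noteq> v" for u v
  proof (cases u)
    case None
    then obtain b where "v = Some b"
      using \<open>u \<noteq> v\<close> by (cases v) auto
    then show ?thesis
      using None alpha_in_G by (intro exI[of _ "alpha b"] exI[of _ "alpha (- b)"]) simp
  next
    case (Some a)
    then have "alpha (- a) v \<noteq> Some 0"
      using \<open>u \<noteq> v\<close> by (cases v) auto
    then obtain b where "t (alpha (- a) v) = Some b"
      using t_eq_None by (metis not_None_eq)
    then have "t (Some b) = alpha (- a) v"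
      by (metis t(1))
    then show ?thesis
      using Some alpha_in_G t_in_G
      by (intro exI[of _ "alpha a \<circ> t \<circ> alpha b"] exI[of _ "alpha (- b) \<circ> t \<circ> alpha (- a)"])
        (simp add: G_comp)
  qed
  show ?thesis
    unfolding sharply_2_transitive_def
  proof (intro allI impI)
    fix u v u' v' :: "'u option"
    assume uv: "u \<noteq> v" "u' \<noteq> v'"
    obtain g g' where g: "g \<in> G" "g' \<in> G" "\<And>z. g (g' z) = z" "\<And>z. g' (g z) = z"
        "g None = u" "g (Some 0) = v"
      using ex[OF uv(1)] by blast
    obtain h h' where h: "h \<in> G" "h' \<in> G" "\<And>z. h (h' z) = z" "\<And>z. h' (h z) = z"
        "h None = u'" "h (Some 0) = v'"
      using ex[OF uv(2)] by blast
    show "\<exists>!f. f \<in> G \<and> f u = u' \<and> f v = v'"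
    proof (rule ex1I[of _ "h \<circ> g'"])
      have "g' u = None" "g' v = Some 0"
        using g by metis+
      then show "h \<circ> g' \<in> G \<and> (h \<circ> g') u = u' \<and> (h \<circ> g') v = v'"
        using G_comp h g by simp
    next
      fix f
      assume f: "f \<in> G \<and> f u = u' \<and> f v = v'"
      have "(h' \<circ> f \<circ> g) z = z" for z
      proof (rule trivial)
        have "h' u' = None" "h' v' = Some 0"
          using h by metis+
        then show "(h' \<circ> f \<circ> g) None = None" "(h' \<circ> f \<circ> g) (Some 0) = Some 0"
          using f g by simp_all
        show "h' \<circ> f \<circ> g \<in> G"
          using f g h by (intro G_comp) auto
      qed
      then have "h (h' (f (g (g' z)))) = h (g' z)" for z
        by simp
      then show "f = h \<circ> g'"
        using g h by (simp add: fun_eq_iff)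
    qed
  qed
qed

text \<open>As \<open>- e = e\<close>, specialness and \<open>gam_at\<close> give
  \<open>- n e e = n e e\<close>; the hexagon relation then makes \<open>n e e\<close> a fixed point
  of \<open>n e\<close>.\<close>

lemma special_involution_fixed:
  assumes e: "special_element \<tau> e" "involution e"
  shows "n e e = e"
proof -
  have e0: "e \<noteq> 0" and me: "- e = e"
    using e(2) by (auto simp: involution_def minus_unique)
  then have at: "at_U \<tau>' e = - at_U \<tau>' (- e)"
    using e(1) by (metis special_element_def minus_minus)
  have "gam (at_U \<tau>' e) None = gam (- at_U \<tau>' (- e)) None"
    by (rule arg_cong[OF at, of "\<lambda>c. gam c None"])
  then have "M e (alpha (n e e) (M e None)) = M e (alpha (- n e (- e)) (M e None))"
    by (simp only: gam_at[OF e0])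
  then have "M e (M e (alpha (n e e) (M e None))) = M e (M e (alpha (- n e e) (M e None)))"
    by (simp only: me)
  then have "- n e e = n e e"
    by (simp add: e0)
  then have "n e (n e e) = n e e"
    using n_hexagon[OF e0] by (simp add: me)
  then show ?thesis
    using e0 by simp
qed

end

section \<open>From hypotheses (a) and (b) to the axioms of \<open>mu_maps\<close>\<close>

theorem proposition3p16:
  fixes \<tau> :: "'u::group_add option \<Rightarrow> 'u option"
  assumes "interchanges_0_infinity \<tau>"
    and "proper_moufang_set (root_groups \<tau>)"
    and "nilpotent_group TYPE('u)"
    and "\<And>b :: 'u. b \<noteq> 0 \<Longrightarrow>
           \<exists>a. a \<in> group_center \<inter> V_set \<tau> b \<and> involution a \<and> special_element \<tau> a"
  shows "elementary_abelian_2_group TYPE('u) \<and> special_moufang \<tau>"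
proof -
  interpret moufang_construction \<tau>
    using assms(1,2) by unfold_locales (simp_all add: proper_moufang_set_def)
  \<comment> \<open>\<open>M (- e)\<close> inverts \<open>M e\<close>, and the involution
    \<open>e\<close> in the class of \<open>x\<close> satisfies \<open>- e = e\<close>.\<close>
  have "mu \<tau> x (mu \<tau> x z) = z" if x: "x \<noteq> 0" for x z
  proof -
    obtain e where "e \<in> V_set \<tau> x" "involution e"
      using assms(4)[OF x] by blast
    then have e: "e \<noteq> 0" "mu \<tau> e = mu \<tau> x" "- e = e"
      by (auto simp: V_set_def involution_def minus_unique)
    then show ?thesis
      using M_minus[OF e(1), of z] by simp
  qed
  then interpret moufang_involutions \<tau>
    by unfold_locales
  have inj: "n x = n y" if "mu \<tau> x = mu \<tau> y" for x y
    using that by (simp add: n_def fun_eq_iff)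
  \<comment> \<open>At \<open>0\<close> both sides take the default value \<open>0\<close>, so the
    transfer also works for an odd number of maps.\<close>
  have from_M: "n x (n y (n z u)) = n w u"
    if "x \<noteq> 0" "y \<noteq> 0" "z \<noteq> 0" "w \<noteq> 0" "\<And>v. mu \<tau> w v = mu \<tau> x (mu \<tau> y (mu \<tau> z v))" for x y z w u
    using that(5)[of "Some u"] that(1-4) by (cases "u = 0") (simp_all add: n_nonzero)
  interpret mu: mu_maps n
  proof
    fix x y v w :: 'u
    assume x: "x \<noteq> 0"
    show "n x 0 = 0" "n x (n x w) = w"
      using x by simp_all
    show "n (- x) = n x"
      using x by (intro inj M_minus_eq)
    show "n (n x x) = n x"
      using x by (intro inj n_self)
    show "n x (- n x (- x)) = - n x x"
      using x by (rule n_hexagon)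
    show "\<exists>e. e \<noteq> 0 \<and> e + e = 0 \<and> (\<forall>w. e + w = w + e) \<and> n e e = e \<and> n e = n x"
    proof -
      obtain e where e: "e \<in> group_center" "e \<in> V_set \<tau> x" "involution e" "special_element \<tau> e"
        using assms(4)[OF x] by blast
      then show ?thesis
        using special_involution_fixed[OF e(4,3)] inj[of e x]
        unfolding group_center_def V_set_def involution_def by blast
    qed
    show "n x (n y (v + w)) = n x (n y v) + n x (n y w)" if "y \<noteq> 0"
      using x that by (rule hua_add)
    show "n x (w + x) = n x (n x w - n x (- x)) + n x x" if "w \<noteq> 0" "w + x \<noteq> 0"
      using x that by (rule n_add)
  next
    fix x y w u :: 'u
    assume *: "x \<noteq> 0" "y \<noteq> 0" "w \<noteq> 0"
    then show "n (n x (n y w)) u = n x (n y (n w (n y (n x u))))"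
      using n_hua[OF *, of "Some u"] n_nonzero by (cases "u = 0") simp_all
  next
    fix x b u :: 'u
    assume *: "x \<noteq> 0" "b \<noteq> 0" "b + b = 0" "n b b = b" "b + x \<noteq> 0"
    have "n x b \<noteq> n x (- x)"
      using n_inject[OF *(1), of b "- x"] *(5) by auto
    then show "n (n x b - n x (- x)) u = n x (n b (n (b + x) u))"
      using from_M[of x b "b + x" "n x b - n x (- x)"] n_sum[OF *] * by simp
  next
    show "\<exists>x y. x \<noteq> 0 \<and> y \<noteq> 0 \<and> n x \<noteq> n y"
    proof (rule ccontr)
      assume "\<not> ?thesis"
      then have const: "\<And>x y. x \<noteq> 0 \<Longrightarrow> y \<noteq> 0 \<Longrightarrow> mu \<tau> x = mu \<tau> y"
        using M_eqI by blast
      \<comment> \<open>A trivial \<open>U\<close> would leave only two points in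
        \<open>X\<close>.\<close>
      have "\<exists>x :: 'u. x \<noteq> 0"
      proof (rule ccontr)
        assume "\<not> (\<exists>x :: 'u. x \<noteq> 0)"
        then have "z = None \<or> z = Some 0" for z :: "'u option"
          by (cases z) auto
        then have *: "(UNIV :: 'u option set) = {None, Some 0}"
          by blast
        have "finite (UNIV :: 'u option set)" "card (UNIV :: 'u option set) = 2"
          by (simp_all add: *)
        then show False
          using moufang by (simp add: moufang_set_def)
      qed
      then show False
        using sharply_2_transitive_if_constant const assms(2)
        unfolding proper_moufang_set_def by blast
    qed
  qed
  have comm: "a + b = b + a" and double: "a + a = 0" for a b :: 'u
    using mu.nilpotent_imp_exponent_2[OF assms(3)] by blast+
  have neg: "- a = a" for a :: 'u
    using double by (rule minus_unique)
  have "special_moufang \<tau>"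
    unfolding special_moufang_def by (simp only: neg simp_thms)
  moreover have "elementary_abelian_2_group TYPE('u)"
    using comm double unfolding elementary_abelian_2_group_def involution_def by blast
  ultimately show ?thesis
    by blast
qed

end
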